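(* Let $A,B\in\mathbb P_n$ and let $a,b\ge0$. Then $$\lambda\bigl(a^2A+b^2B+2ab(A\#B)\bigr)\prec_w\lambda\bigl(W_{a,b}(A,B)\bigr),$$ where $W_{a,b}(A,B)=a^2A+b^2B+ab\bigl((AB)^{1/2}+(BA)^{1/2}\bigr)$. Consequently, $$\|a^2A+b^2B+2ab(A\#B)\|\le\|W_{a,b}(A,B)\|$$ for every unitarily invariant norm $\|\cdot\|$ on $n\times n$ complex matrices.
   Context: $\mathbb P_n$ is the set of $n\times n$ complex (Hermitian) positive definite matrices. For a Hermitian matrix $T$, $\lambda(T)$ is the vector of eigenvalues in decreasing order. For $x,y\in\mathbb R^n$ with decreasing rearrangements $x^\downarrow,y^\downarrow$, $x\prec_w y$ means $\sum_{j=1}^k x_j^\downarrow\le\sum_{j=1}^k y_j^\downarrow$ for all $1\le k\le n$. For $P,Q\in\mathbb P_n$, $P\#Q=P^{1/2}(P^{-1/2}QP^{-1/2})^{1/2}P^{1/2}$ is the Kubo-Ando geometric mean. For $A,B\in\mathbb P_n$ the product $AB$ has positive spectrum and $(AB)^{1/2}$ denotes its principal square root (the unique square root with spectrum in $(0,\infty)$); the sum $(AB)^{1/2}+(BA)^{1/2}$ is Hermitian. *)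

theory Defs
  imports
    "Jordan_Normal_Form.Schur_Decomposition"
    "Jordan_Normal_Form.Spectral_Radius"
begin

definition hermitian_mat :: "complex mat \<Rightarrow> bool" where
  "hermitian_mat A \<longleftrightarrow> square_mat A \<and> mat_adjoint A = A"

definition unitary_mat :: "complex mat \<Rightarrow> bool" where
  "unitary_mat U \<longleftrightarrow>
     square_mat U \<and> U * mat_adjoint U = 1\<^sub>m (dim_row U) \<and> mat_adjoint U * U = 1\<^sub>m (dim_row U)"

text \<open>For a Hermitian matrix the quadratic form is real, so taking the real part loses nothing.\<close>

definition posdef_mats :: "nat \<Rightarrow> complex mat set" where
  "posdef_mats n = {A \<in> carrier_mat n n. hermitian_mat A \<and>
     (\<forall>v \<in> carrier_vec n. v \<noteq> 0\<^sub>v n \<longrightarrow> Re ((A *\<^sub>v v) \<bullet>c v) > 0)}"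

definition decreasing :: "real list \<Rightarrow> real list" where
  "decreasing x = rev (sort x)"

text \<open>Eigenvalues are counted with algebraic multiplicity. The definition is meant for Hermitian
  matrices only; all roots of the characteristic polynomial are then real, so that the real part
  is merely a change of type.\<close>

definition eigvals_decreasing :: "complex mat \<Rightarrow> real list" where
  "eigvals_decreasing T =
     rev (sorted_list_of_multiset (image_mset Re (proots (char_poly T))))"

text \<open>Vectors of $\mathbb{R}^n$ are lists of length $n$.\<close>

definition weakly_majorized :: "real list \<Rightarrow> real list \<Rightarrow> bool" (infix "\<prec>\<^sub>w" 50) where
  "x \<prec>\<^sub>w y \<longleftrightarrow> length x = length y \<and>
     (\<forall>k \<in> {1..length x}. sum_list (take k (decreasing x)) \<le> sum_list (take k (decreasing y)))"

text \<open>Positive definite square root of a positive definite matrix.\<close>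

definition posdef_sqrt :: "complex mat \<Rightarrow> complex mat" where
  "posdef_sqrt P = (THE R. R \<in> posdef_mats (dim_row P) \<and> R * R = P)"

definition mat_inv :: "complex mat \<Rightarrow> complex mat" where
  "mat_inv A = the (mat_inverse A)"

text \<open>Principal square root of a (not necessarily Hermitian) matrix that has one with spectrum
  in $(0,\infty)$, such as a product of two positive definite matrices.\<close>

definition principal_sqrt :: "complex mat \<Rightarrow> complex mat" where
  "principal_sqrt M = (THE R. R \<in> carrier_mat (dim_row M) (dim_row M) \<and> R * R = M \<and>
     spectrum R \<subseteq> complex_of_real ` {0<..})"

definition geometric_mean :: "complex mat \<Rightarrow> complex mat \<Rightarrow> complex mat" (infixl "\<sharp>" 70) where
  "P \<sharp> Q = (let R = posdef_sqrt P; S = mat_inv R in R * posdef_sqrt (S * Q * S) * R)"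

definition W_mat :: "real \<Rightarrow> real \<Rightarrow> complex mat \<Rightarrow> complex mat \<Rightarrow> complex mat" where
  "W_mat a b A B =
     complex_of_real (a\<^sup>2) \<cdot>\<^sub>m A + complex_of_real (b\<^sup>2) \<cdot>\<^sub>m B
       + complex_of_real (a * b) \<cdot>\<^sub>m (principal_sqrt (A * B) + principal_sqrt (B * A))"

text \<open>The values of the function outside the \<open>n \<times> n\<close> matrices are irrelevant.\<close>

definition unitarily_invariant_norm :: "nat \<Rightarrow> (complex mat \<Rightarrow> real) \<Rightarrow> bool" where
  "unitarily_invariant_norm n N \<longleftrightarrow>
     (\<forall>X \<in> carrier_mat n n. N X \<ge> 0 \<and> (N X = 0 \<longleftrightarrow> X = 0\<^sub>m n n)) \<and>
     (\<forall>X \<in> carrier_mat n n. \<forall>c. N (c \<cdot>\<^sub>m X) = cmod c * N X) \<and>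
     (\<forall>X \<in> carrier_mat n n. \<forall>Y \<in> carrier_mat n n. N (X + Y) \<le> N X + N Y) \<and>
     (\<forall>X \<in> carrier_mat n n. \<forall>U \<in> carrier_mat n n. \<forall>V \<in> carrier_mat n n.
        unitary_mat U \<longrightarrow> unitary_mat V \<longrightarrow> N (U * X * V) = N X)"

end

theory Submission
  imports Defs
begin

text \<open>Let \<open>H\<close> be the positive definite solution of \<open>H A H = B\<close>. Then \<open>(AB)\<^bsup>1/2\<^esup> = A H\<close> and
  \<open>(BA)\<^bsup>1/2\<^esup> = H A\<close> (lemma \<open>principal_sqrt_transport\<close>), so the right-hand matrix is a congruence,
  \<open>W = K A K\<close> with \<open>K = a + b H\<close>. The geometric mean is \<open>A \<sharp> B = A Z\<close> for a matrix \<open>Z\<close> with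
  \<open>Z\<^sup>* A Z = B\<close> (lemma \<open>geometric_mean_transport\<close>). Two properties of the mean are used: it is
  monotone in both arguments (\<open>loewner_le_mean\<close>), and its trace is at most that of \<open>A H\<close>
  (\<open>re_trace_mean_le\<close>).

  Write \<open>M\<close> for the left-hand matrix and \<open>M = \<Phi>(W)\<close> for its dependence on \<open>W\<close> when \<open>H\<close> is held fixed
  and \<open>A = K\<^sup>-\<^sup>1 W K\<^sup>-\<^sup>1\<close>, \<open>B = H A H\<close>. Then \<open>\<Phi>\<close> is monotone, does not increase the trace, and
  fixes scalar matrices, for which everything commutes. These three properties alone give weak majorization.
  For given \<open>k\<close> let \<open>t\<close> be the \<open>k\<close>-th eigenvalue of \<open>W\<close> and let \<open>W'\<close> arise from \<open>W\<close> by raising all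
  eigenvalues below \<open>t\<close> to \<open>t\<close>. Then \<open>M' = \<Phi>(W')\<close> lies above both \<open>M\<close> and \<open>t\<close>, and its trace is at
  most that of \<open>W'\<close> (\<open>mean_majorant\<close>). So the \<open>k\<close> largest eigenvalues of \<open>M\<close> add up to at most
  \<open>tr M' - (n - k) t \<le> tr W' - (n - k) t\<close>, which is the sum of the \<open>k\<close> largest eigenvalues of \<open>W\<close>
  (\<open>partial_sums_le\<close>).

  The norm inequality follows by Ky Fan dominance: on positive semidefinite matrices a unitarily
  invariant norm is a symmetric gauge function of the eigenvalues, and such functions respect weak
  majorization of nonnegative vectors, because \<open>x\<close> is reached from \<open>y\<close> by finitely many
  transfers between two entries and decreases of single entries (\<open>gauge_dominance\<close>).

  The spectral theorem, on which all of this rests, is proved by successive Householder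
  reflections (\<open>decouple_next_coordinate\<close>). The matrix functions in the statement are identified by
  uniqueness of square roots with positive spectrum (\<open>square_root_unique\<close>).\<close>

section \<open>Adjoints, inner products and quadratic forms\<close>

lemma mat_adjoint_dim [simp]:
  "dim_row (mat_adjoint A) = dim_col A" "dim_col (mat_adjoint A) = dim_row A"
  by (auto simp: mat_adjoint_def)

lemma mat_adjoint_carrier [simp]:
  "A \<in> carrier_mat n m \<Longrightarrow> mat_adjoint A \<in> carrier_mat m n"
  by (intro carrier_matI) simp_all

lemma mat_adjoint_index [simp]:
  "i < dim_col A \<Longrightarrow> j < dim_row A \<Longrightarrow> mat_adjoint A $$ (i, j) = cnj (A $$ (j, i))"
  by (auto simp: mat_adjoint_def mat_of_rows_def)

lemma mat_adjoint_adjoint [simp]: "mat_adjoint (mat_adjoint A) = (A :: complex mat)"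
  by (rule eq_matI) auto

lemma mat_adjoint_mult:
  assumes "A \<in> carrier_mat n m" and "B \<in> carrier_mat m k"
  shows "mat_adjoint (A * B) = mat_adjoint B * mat_adjoint (A :: complex mat)"
  by (rule eq_matI) (use assms in \<open>auto simp: scalar_prod_def mult.commute\<close>)

lemma mat_adjoint_add:
  assumes "A \<in> carrier_mat n m" and "B \<in> carrier_mat n m"
  shows "mat_adjoint (A + B) = mat_adjoint A + mat_adjoint (B :: complex mat)"
  by (rule eq_matI) (use assms in auto)

lemma mat_adjoint_minus:
  assumes "A \<in> carrier_mat n m" and "B \<in> carrier_mat n m"
  shows "mat_adjoint (A - B) = mat_adjoint A - mat_adjoint (B :: complex mat)"
  by (rule eq_matI) (use assms in auto)

lemma mat_adjoint_smult: "mat_adjoint (c \<cdot>\<^sub>m A) = cnj c \<cdot>\<^sub>m mat_adjoint A"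
  by (rule eq_matI) auto

lemma mat_adjoint_one [simp]: "mat_adjoint (1\<^sub>m n :: complex mat) = 1\<^sub>m n"
  by (rule eq_matI) auto

lemma cscalar_prod_adjoint:
  fixes A :: "complex mat" and v w :: "complex vec"
  assumes "A \<in> carrier_mat n m" and "v \<in> carrier_vec m" and "w \<in> carrier_vec n"
  shows "(A *\<^sub>v v) \<bullet>c w = v \<bullet>c (mat_adjoint A *\<^sub>v w)"
proof -
  have "(A *\<^sub>v v) \<bullet>c w = (\<Sum>i<n. \<Sum>j<m. A $$ (i, j) * v $ j * cnj (w $ i))"
    using assms by (auto simp: scalar_prod_def lessThan_atLeast0 sum_distrib_right)
  also have "\<dots> = (\<Sum>j<m. \<Sum>i<n. A $$ (i, j) * v $ j * cnj (w $ i))"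
    by (rule sum.swap)
  also have "\<dots> = v \<bullet>c (mat_adjoint A *\<^sub>v w)"
    using assms by (auto simp: scalar_prod_def lessThan_atLeast0 sum_distrib_left mult_ac)
  finally show ?thesis .
qed

lemma cscalar_prod_commute:
  fixes v w :: "complex vec"
  assumes "v \<in> carrier_vec n" and "w \<in> carrier_vec n"
  shows "w \<bullet>c v = cnj (v \<bullet>c w)"
  using assms by (auto simp: scalar_prod_def mult.commute)

lemma cscalar_prod_add_left:
  fixes u v w :: "complex vec"
  assumes "u \<in> carrier_vec n" and "v \<in> carrier_vec n" and "w \<in> carrier_vec n"
  shows "(u + v) \<bullet>c w = u \<bullet>c w + v \<bullet>c w"
  using assms by (auto simp: scalar_prod_def sum.distrib distrib_right)

lemma cscalar_prod_minus_left:
  fixes u v w :: "complex vec"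
  assumes "u \<in> carrier_vec n" and "v \<in> carrier_vec n" and "w \<in> carrier_vec n"
  shows "(u - v) \<bullet>c w = u \<bullet>c w - v \<bullet>c w"
  using assms by (auto simp: scalar_prod_def sum_subtractf left_diff_distrib)

lemma cscalar_prod_minus_right:
  fixes u v w :: "complex vec"
  assumes "u \<in> carrier_vec n" and "v \<in> carrier_vec n" and "w \<in> carrier_vec n"
  shows "w \<bullet>c (u - v) = w \<bullet>c u - w \<bullet>c v"
  using assms by (auto simp: scalar_prod_def sum_subtractf right_diff_distrib)

lemma cscalar_prod_smult_left:
  fixes v w :: "complex vec"
  assumes "v \<in> carrier_vec n" and "w \<in> carrier_vec n"
  shows "(c \<cdot>\<^sub>v v) \<bullet>c w = c * (v \<bullet>c w)"
  using assms by (auto simp: scalar_prod_def sum_distrib_left mult_ac)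

lemma cscalar_prod_smult_right:
  fixes v w :: "complex vec"
  assumes "v \<in> carrier_vec n" and "w \<in> carrier_vec n"
  shows "w \<bullet>c (c \<cdot>\<^sub>v v) = cnj c * (w \<bullet>c v)"
  using assms by (auto simp: scalar_prod_def sum_distrib_left mult_ac)

lemma cscalar_prod_self:
  assumes "v \<in> carrier_vec n"
  shows "v \<bullet>c v = complex_of_real (\<Sum>i<n. (cmod (v $ i))\<^sup>2)"
  using assms by (auto simp: scalar_prod_def lessThan_atLeast0 complex_norm_square simp del: of_real_power)

lemma cscalar_prod_pos:
  fixes v :: "complex vec"
  assumes "v \<in> carrier_vec n" and "v \<noteq> 0\<^sub>v n"
  shows "Re (v \<bullet>c v) > 0"
  using assms conjugate_square_greater_0_vec[OF assms(1)] by (auto simp: less_complex_def)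

definition qform :: "complex mat \<Rightarrow> complex vec \<Rightarrow> real" where
  "qform A v = Re ((A *\<^sub>v v) \<bullet>c v)"

definition loewner_le :: "nat \<Rightarrow> complex mat \<Rightarrow> complex mat \<Rightarrow> bool" where
  "loewner_le n A B \<longleftrightarrow> (\<forall>v \<in> carrier_vec n. qform A v \<le> qform B v)"

lemma qform_add:
  assumes "A \<in> carrier_mat n n" "B \<in> carrier_mat n n" "v \<in> carrier_vec n"
  shows "qform (A + B) v = qform A v + qform B v"
proof -
  have "A *\<^sub>v v \<in> carrier_vec n" "B *\<^sub>v v \<in> carrier_vec n" using assms by auto
  then show ?thesis using assms
    by (simp add: qform_def add_mult_distrib_mat_vec[of _ n n] cscalar_prod_add_left[of _ n])
qed

lemma qform_smult:
  assumes "A \<in> carrier_mat n n" "v \<in> carrier_vec n"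
  shows "qform (complex_of_real c \<cdot>\<^sub>m A) v = c * qform A v"
proof -
  have "(complex_of_real c \<cdot>\<^sub>m A) *\<^sub>v v = complex_of_real c \<cdot>\<^sub>v (A *\<^sub>v v)"
    using assms by (auto intro!: eq_vecI)
  moreover have "A *\<^sub>v v \<in> carrier_vec n" using assms by auto
  ultimately show ?thesis using assms by (simp add: qform_def cscalar_prod_smult_left[of _ n])
qed

lemma qform_congruence:
  assumes "A \<in> carrier_mat n n" "C \<in> carrier_mat n n" "v \<in> carrier_vec n"
  shows "qform (mat_adjoint C * A * C) v = qform A (C *\<^sub>v v)"
proof -
  have "(mat_adjoint C * A * C) *\<^sub>v v = mat_adjoint C *\<^sub>v (A *\<^sub>v (C *\<^sub>v v))"
    using assms by (simp add: assoc_mult_mat_vec[of _ n n _ n] assoc_mult_mat[of _ n n _ n _ n])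
  also have "\<dots> \<bullet>c v = (A *\<^sub>v (C *\<^sub>v v)) \<bullet>c (C *\<^sub>v v)"
    using cscalar_prod_adjoint[of "mat_adjoint C" n n "A *\<^sub>v (C *\<^sub>v v)" v] assms by simp
  finally show ?thesis by (simp add: qform_def)
qed

lemma posdef_matsD:
  assumes "A \<in> posdef_mats n"
  shows "A \<in> carrier_mat n n" "mat_adjoint A = A"
    "v \<in> carrier_vec n \<Longrightarrow> v \<noteq> 0\<^sub>v n \<Longrightarrow> qform A v > 0"
  using assms by (auto simp: posdef_mats_def hermitian_mat_def qform_def)

lemma posdef_matsI:
  assumes "A \<in> carrier_mat n n" "mat_adjoint A = A"
    "\<And>v. v \<in> carrier_vec n \<Longrightarrow> v \<noteq> 0\<^sub>v n \<Longrightarrow> qform A v > 0"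
  shows "A \<in> posdef_mats n"
  using assms by (auto simp: posdef_mats_def hermitian_mat_def qform_def)

lemma qform_posdef_ge_0:
  assumes "A \<in> posdef_mats n" "v \<in> carrier_vec n"
  shows "qform A v \<ge> 0"
proof (cases "v = 0\<^sub>v n")
  case True
  then show ?thesis using posdef_matsD(1)[OF assms(1)]
    by (auto simp: qform_def scalar_prod_def)
next
  case False
  then show ?thesis using posdef_matsD(3)[OF assms] by simp
qed

section \<open>The spectral theorem\<close>

text \<open>Square matrices of one size form a ring only relative to a carrier, and the general laws leave
  the inner dimensions undetermined in rewriting. Instantiating every dimension by one \<open>n\<close> makes
  them usable as rewrite rules: \<open>sq_mult\<close> brings products into right-nested form with adjoints
  at the leaves, \<open>sq_distrib\<close> expands sums and scalar multiples.\<close>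

lemmas sq_mult = assoc_mult_mat[of _ n n _ n _ n] mult_carrier_mat[of _ n n _ n]
  mat_adjoint_mult[of _ n n _ n] mat_adjoint_carrier[of _ n n] for n

lemmas sq_distrib = add_mult_distrib_mat[of _ n n _ _ n] mult_add_distrib_mat[of _ n n _ n]
  minus_mult_distrib_mat[of _ n n _ _ n] mult_minus_distrib_mat[of _ n n _ n]
  mult_smult_distrib[of _ n n _ n] mult_smult_assoc_mat[of _ n n _ n]
  mat_adjoint_add[of _ n n] mat_adjoint_minus[of _ n n] minus_carrier_mat[of _ n n] for n

lemma unitary_matD:
  assumes "unitary_mat U" and "U \<in> carrier_mat n n"
  shows "U * mat_adjoint U = 1\<^sub>m n" "mat_adjoint U * U = 1\<^sub>m n"
  using assms by (auto simp: unitary_mat_def)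

lemma unitary_matI:
  assumes "U \<in> carrier_mat n n" and "U * mat_adjoint U = 1\<^sub>m n" and "mat_adjoint U * U = 1\<^sub>m n"
  shows "unitary_mat U"
  using assms by (auto simp: unitary_mat_def)

lemma unitary_mat_mult:
  assumes "unitary_mat U" "U \<in> carrier_mat n n" "unitary_mat V" "V \<in> carrier_mat n n"
  shows "unitary_mat (U * V)"
proof (rule unitary_matI[of _ n])
  note D = unitary_matD[OF assms(1,2)] unitary_matD[OF assms(3,4)]
  have "U * V * mat_adjoint (U * V) = U * (V * mat_adjoint V) * mat_adjoint U"
    using assms by (simp add: sq_mult[where n=n])
  then show "U * V * mat_adjoint (U * V) = 1\<^sub>m n" using D assms by simp
  have "mat_adjoint (U * V) * (U * V) = mat_adjoint V * (mat_adjoint U * U) * V"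
    using assms by (simp add: sq_mult[where n=n])
  then show "mat_adjoint (U * V) * (U * V) = 1\<^sub>m n" using D assms by simp
qed (use assms in auto)

lemma unitary_mat_adjoint:
  assumes "unitary_mat U" "U \<in> carrier_mat n n"
  shows "unitary_mat (mat_adjoint U)"
  by (rule unitary_matI[of _ n]) (use assms unitary_matD[OF assms] in auto)

text \<open>Subtracting the orthogonal projection onto \<open>w = v - e\<^sub>k\<close> twice gives the reflection that exchanges
  \<open>v\<close> and \<open>e\<^sub>k\<close>, which have equal length; it fixes every coordinate vector orthogonal to \<open>w\<close>. The
  sign condition on \<open>v $ k\<close> keeps \<open>w\<close> away from zero, since \<open>w\<close> has squared length \<open>2 (1 - r)\<close>.\<close>

lemma householder_reflection:
  fixes v :: "complex vec"
  assumes v: "v \<in> carrier_vec n" and unit: "(\<Sum>i<n. (cmod (v $ i))\<^sup>2) = 1"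
    and k: "k < n" and vk: "v $ k = complex_of_real r" "r \<le> 0"
  obtains F where "F \<in> carrier_mat n n" "mat_adjoint F = F" "F * F = 1\<^sub>m n" "col F k = v"
    "\<And>j. j < n \<Longrightarrow> j \<noteq> k \<Longrightarrow> v $ j = 0 \<Longrightarrow> col F j = unit_vec n j"
proof -
  define s where "s = complex_of_real (1 - r)"
  define w where "w i = v $ i - (if i = k then 1 else 0)" for i
  define F where "F = mat n n (\<lambda>(i, j). (if i = j then 1 else 0) - w i * cnj (w j) / s)"
  have s0: "s \<noteq> 0" using vk(2) unfolding s_def of_real_eq_0_iff by simp
  have cs: "cnj s = s" by (simp add: s_def)
  have wk: "w k = - s" using vk by (simp add: w_def s_def)
  have F: "F \<in> carrier_mat n n" by (simp add: F_def)
  have "(\<Sum>i<n. (cmod (w i))\<^sup>2) = (cmod (w k))\<^sup>2 + (\<Sum>i\<in>{..<n} - {k}. (cmod (v $ i))\<^sup>2)"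
    using k by (subst sum.remove[of _ k]) (auto simp: w_def intro!: sum.cong)
  also have "(\<Sum>i\<in>{..<n} - {k}. (cmod (v $ i))\<^sup>2) = 1 - r\<^sup>2"
    using unit k vk by (subst (asm) sum.remove[of _ k]) auto
  also have "cmod (w k) = 1 - r" using vk(2) unfolding wk s_def norm_minus_cancel norm_of_real by simp
  finally have "(\<Sum>i<n. (cmod (w i))\<^sup>2) = 2 * (1 - r)"
    by (simp add: power2_eq_square algebra_simps)
  then have "complex_of_real (\<Sum>i<n. (cmod (w i))\<^sup>2) = 2 * s" by (simp add: s_def)
  then have ww: "(\<Sum>l<n. cnj (w l) * w l) = 2 * s"
    by (simp add: complex_norm_square mult.commute del: of_real_power)
  have adj: "mat_adjoint F = F"
    by (rule eq_matI) (auto simp: F_def cs mult.commute)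
  have FF: "F * F = 1\<^sub>m n"
  proof (rule eq_matI)
    fix i j assume "i < dim_row (1\<^sub>m n :: complex mat)" "j < dim_col (1\<^sub>m n :: complex mat)"
    then have ij: "i < n" "j < n" by auto
    let ?d = "\<lambda>i j. (if i = j then 1 else 0 :: complex)"
    have "(F * F) $$ (i, j) = (\<Sum>l<n. (?d i l - w i * cnj (w l) / s) * (?d l j - w l * cnj (w j) / s))"
      using ij F by (simp add: scalar_prod_def lessThan_atLeast0) (simp add: F_def)
    also have "\<dots> = (\<Sum>l<n. (if l = i then ?d l j else 0) - (if l = i then w l * cnj (w j) / s else 0)
         - (if l = j then w i * cnj (w l) / s else 0) + w i * cnj (w j) / s\<^sup>2 * (cnj (w l) * w l))"
      by (rule sum.cong) (auto simp: algebra_simps power2_eq_square)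
    also have "\<dots> = ?d i j - w i * cnj (w j) / s - w i * cnj (w j) / s
         + w i * cnj (w j) / s\<^sup>2 * (2 * s)"
      unfolding sum.distrib sum_subtractf sum_distrib_left[symmetric] ww using ij by simp
    also have "\<dots> = ?d i j" using s0 by (simp add: field_simps power2_eq_square)
    finally show "(F * F) $$ (i, j) = 1\<^sub>m n $$ (i, j)" using ij by simp
  qed (use F in auto)
  have col_k: "col F k = v"
    by (rule eq_vecI) (use v k s0 in \<open>auto simp: F_def wk cs\<close>, auto simp: w_def vk(1) s_def)
  have "col F j = unit_vec n j" if "j < n" "j \<noteq> k" "v $ j = 0" for j
    by (rule eq_vecI) (use that in \<open>auto simp: F_def w_def\<close>)
  with F adj FF col_k show ?thesis using that by blast
qed

text \<open>The first \<open>k\<close> coordinates are already decoupled, so an eigenvector of the remaining block, padded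
  with zeros, is an eigenvector of the whole matrix. A Householder reflection makes it the next
  coordinate vector; as its first \<open>k\<close> entries vanish, the reflection leaves the earlier coordinate
  vectors in place. Iterating this diagonalises a Hermitian matrix without splitting it into blocks.\<close>

lemma decouple_next_coordinate:
  fixes C :: "complex mat"
  assumes C: "C \<in> carrier_mat n n" and herm: "mat_adjoint C = C" and k: "k < n"
    and dec: "\<And>i j. i < n \<Longrightarrow> j < k \<Longrightarrow> i \<noteq> j \<Longrightarrow> C $$ (i, j) = 0"
  obtains F where "F \<in> carrier_mat n n" "mat_adjoint F = F" "F * F = 1\<^sub>m n"
    "\<And>i j. i < n \<Longrightarrow> j < Suc k \<Longrightarrow> i \<noteq> j \<Longrightarrow> (F * C * F) $$ (i, j) = 0"
proof -
  define C' where "C' = mat (n - k) (n - k) (\<lambda>(i, j). C $$ (i + k, j + k))"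
  have C': "C' \<in> carrier_mat (n - k) (n - k)" by (simp add: C'_def)
  have "n - k > 0" using k by simp
  then obtain e x where ex: "eigenvector C' x e"
    using spectrum_non_empty[of C' "n - k"] C' by (auto simp: spectrum_def eigenvalue_def)
  then have x: "x \<in> carrier_vec (n - k)" "x \<noteq> 0\<^sub>v (n - k)" "C' *\<^sub>v x = e \<cdot>\<^sub>v x"
    using C' by (auto simp: eigenvector_def)
  define y where "y = vec n (\<lambda>i. if i < k then 0 else x $ (i - k))"
  have y: "y \<in> carrier_vec n" by (simp add: y_def)
  have y0: "y \<noteq> 0\<^sub>v n"
  proof
    assume "y = 0\<^sub>v n"
    then have "y $ (i + k) = 0" if "i < n - k" for i using that by simp
    then have "x = 0\<^sub>v (n - k)" using x(1) by (intro eq_vecI) (auto simp: y_def)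
    with x(2) show False by simp
  qed
  have dec': "C $$ (i, j) = 0" if "i < k" "j < n" "i \<noteq> j" for i j
  proof -
    have "mat_adjoint C $$ (i, j) = cnj (C $$ (j, i))" using that C k by simp
    then show ?thesis using dec[of j i] that herm by simp
  qed
  have Cy: "C *\<^sub>v y = e \<cdot>\<^sub>v y"
  proof (rule eq_vecI)
    fix i assume "i < dim_vec (e \<cdot>\<^sub>v y)"
    then have i: "i < n" using y by simp
    have "(C *\<^sub>v y) $ i = (\<Sum>j<n. C $$ (i, j) * y $ j)"
      using C y i by (auto simp: scalar_prod_def lessThan_atLeast0)
    also have "\<dots> = (\<Sum>j\<in>{k..<n}. C $$ (i, j) * y $ j)"
      by (rule sum.mono_neutral_right) (auto simp: y_def)
    also have "\<dots> = (\<Sum>j<n - k. C $$ (i, j + k) * x $ j)"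
      by (rule sum.reindex_bij_witness[of _ "\<lambda>j. j + k" "\<lambda>j. j - k"]) (auto simp: y_def)
    also have "\<dots> = (e \<cdot>\<^sub>v y) $ i"
    proof (cases "i < k")
      case True
      then show ?thesis using dec' i by (auto simp: y_def intro!: sum.neutral)
    next
      case False
      then have "(\<Sum>j<n - k. C $$ (i, j + k) * x $ j) = (C' *\<^sub>v x) $ (i - k)"
        using x(1) i by (auto simp: C'_def scalar_prod_def lessThan_atLeast0)
      then show ?thesis using False x i by (simp add: y_def)
    qed
    finally show "(C *\<^sub>v y) $ i = (e \<cdot>\<^sub>v y) $ i" .
  qed (use C y in simp)
  define N where "N = sqrt (\<Sum>i<n. (cmod (y $ i))\<^sup>2)"
  have N: "N > 0" "(\<Sum>i<n. (cmod (y $ i))\<^sup>2) = N\<^sup>2"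
    using cscalar_prod_pos[OF y y0] unfolding cscalar_prod_self[OF y] by (auto simp: N_def)
  \<comment> \<open>A unimodular factor turning the \<open>k\<close>-th entry into a nonpositive real number.\<close>
  define p where "p = (if y $ k = 0 then 1 else - cnj (sgn (y $ k)))"
  have p: "cmod p = 1" "p * y $ k = complex_of_real (- cmod (y $ k))"
  proof -
    show "cmod p = 1" by (auto simp: p_def norm_sgn)
    have "cnj (sgn z) * z = complex_of_real (cmod z)" for z
      by (cases "z = 0")
        (auto simp: sgn_div_norm complex_norm_square[symmetric] mult.commute scaleR_conv_of_real
          power2_eq_square field_simps simp del: of_real_power simp flip: of_real_mult)
    then show "p * y $ k = complex_of_real (- cmod (y $ k))"
      by (auto simp: p_def)
  qed
  define v where "v = (p / N) \<cdot>\<^sub>v y"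
  have v: "v \<in> carrier_vec n" using y by (simp add: v_def)
  have "(\<Sum>i<n. (cmod (v $ i))\<^sup>2) = (\<Sum>i<n. (cmod (y $ i))\<^sup>2 / N\<^sup>2)"
    using y p(1) N by (intro sum.cong) (auto simp: v_def norm_mult norm_divide power_divide)
  also have "\<dots> = 1" using N by (simp flip: sum_divide_distrib)
  finally have unit: "(\<Sum>i<n. (cmod (v $ i))\<^sup>2) = 1" .
  have vk: "v $ k = complex_of_real (- (cmod (y $ k) / N))"
    using y k p(2) by (simp add: v_def)
  have neg: "- (cmod (y $ k) / N) \<le> 0" using N by simp
  obtain F where F: "F \<in> carrier_mat n n" "mat_adjoint F = F" "F * F = 1\<^sub>m n" "col F k = v"
    "\<And>j. j < n \<Longrightarrow> j \<noteq> k \<Longrightarrow> v $ j = 0 \<Longrightarrow> col F j = unit_vec n j"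
    using householder_reflection[OF v unit k vk neg] by blast
  have Cv: "C *\<^sub>v v = e \<cdot>\<^sub>v v"
    using Cy y C by (simp add: v_def mult_mat_vec[of _ n n] smult_smult_assoc mult.commute)
  have Fe: "F *\<^sub>v (C *\<^sub>v col F j) = c \<cdot>\<^sub>v unit_vec n j"
    if "j < n" "C *\<^sub>v col F j = c \<cdot>\<^sub>v col F j" for j c
  proof -
    have "F *\<^sub>v col F j = col (F * F) j" using col_mult2[OF F(1) F(1) that(1)] ..
    then have "F *\<^sub>v col F j = unit_vec n j" using that(1) F(3) by simp
    then show ?thesis using that F(1) by (simp add: mult_mat_vec[of _ n n])
  qed
  have "(F * C * F) $$ (i, j) = 0" if "i < n" "j < Suc k" "i \<noteq> j" for i j
  proof -
    have j: "j < n" using that k by simp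
    have "\<exists>c. C *\<^sub>v col F j = c \<cdot>\<^sub>v col F j"
    proof (cases "j = k")
      case True
      then show ?thesis using Cv F(4) by auto
    next
      case False
      then have jk: "j < k" using that by simp
      have "col F j = unit_vec n j" using F(5)[OF j False] jk j y by (simp add: v_def y_def)
      moreover have "C *\<^sub>v unit_vec n j = C $$ (j, j) \<cdot>\<^sub>v unit_vec n j"
        by (rule eq_vecI) (use C j jk dec in \<open>auto simp: scalar_prod_right_unit\<close>)
      ultimately show ?thesis by auto
    qed
    then obtain c where "F *\<^sub>v (C *\<^sub>v col F j) = c \<cdot>\<^sub>v unit_vec n j" using Fe j by blast
    moreover have "(F * C * F) $$ (i, j) = (F *\<^sub>v (C *\<^sub>v col F j)) $ i"
    proof -
      have CF: "C * F \<in> carrier_mat n n" using C F(1) by simp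
      have "F *\<^sub>v (C *\<^sub>v col F j) = col (F * (C * F)) j"
        unfolding col_mult2[OF F(1) CF j] col_mult2[OF C F(1) j] ..
      also have "F * (C * F) = F * C * F" using assoc_mult_mat[OF F(1) C F(1)] ..
      finally have "F *\<^sub>v (C *\<^sub>v col F j) = col (F * C * F) j" .
      moreover have "i < dim_row (F * C * F)" "j < dim_col (F * C * F)" using F(1) that j by auto
      ultimately show ?thesis by (simp only: index_col)
    qed
    ultimately show ?thesis using that j by (simp add: unit_vec_def)
  qed
  with F that show ?thesis by blast
qed

theorem spectral_theorem:
  fixes A :: "complex mat"
  assumes A: "A \<in> carrier_mat n n" and herm: "mat_adjoint A = A"
  obtains U d where "U \<in> carrier_mat n n" "unitary_mat U"
    "A = U * mat_diag n (\<lambda>i. complex_of_real (d i)) * mat_adjoint U"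
proof -
  have "\<exists>U. U \<in> carrier_mat n n \<and> unitary_mat U \<and>
      (\<forall>i<n. \<forall>j<k. i \<noteq> j \<longrightarrow> (mat_adjoint U * A * U) $$ (i, j) = 0)" if "k \<le> n" for k
    using that
  proof (induction k)
    case 0
    have "unitary_mat (1\<^sub>m n)" by (rule unitary_matI[of _ n]) auto
    then show ?case by (intro exI[of _ "1\<^sub>m n"]) auto
  next
    case (Suc k)
    then obtain U where U: "U \<in> carrier_mat n n" "unitary_mat U"
      and dec: "\<And>i j. i < n \<Longrightarrow> j < k \<Longrightarrow> i \<noteq> j \<Longrightarrow> (mat_adjoint U * A * U) $$ (i, j) = 0"
      by auto
    let ?C = "mat_adjoint U * A * U"
    have C: "?C \<in> carrier_mat n n" using U A by (simp add: sq_mult[where n=n])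
    have CH: "mat_adjoint ?C = ?C"
      using U A herm by (simp add: sq_mult[where n=n])
    have kn: "k < n" using Suc.prems by simp
    obtain F where F: "F \<in> carrier_mat n n" "mat_adjoint F = F" "F * F = 1\<^sub>m n"
      "\<And>i j. i < n \<Longrightarrow> j < Suc k \<Longrightarrow> i \<noteq> j \<Longrightarrow> (F * ?C * F) $$ (i, j) = 0"
      using decouple_next_coordinate[OF C CH kn dec] by blast
    have "unitary_mat F" by (rule unitary_matI[of _ n]) (use F in auto)
    then have "unitary_mat (U * F)" using unitary_mat_mult U F(1) by blast
    moreover have "mat_adjoint (U * F) * A * (U * F) = F * ?C * F"
      using U A F(1,2) by (simp add: sq_mult[where n=n])
    ultimately show ?case using F U by (intro exI[of _ "U * F"]) auto
  qed
  from this[of n] obtain U where U: "U \<in> carrier_mat n n" "unitary_mat U"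
    and dec: "\<And>i j. i < n \<Longrightarrow> j < n \<Longrightarrow> i \<noteq> j \<Longrightarrow> (mat_adjoint U * A * U) $$ (i, j) = 0"
    by auto
  define C where "C = mat_adjoint U * A * U"
  have C: "C \<in> carrier_mat n n" using U A by (simp add: C_def sq_mult[where n=n])
  have CH: "mat_adjoint C = C" unfolding C_def
    using U A herm by (simp add: sq_mult[where n=n])
  define d where "d i = Re (C $$ (i, i))" for i
  have "C $$ (i, i) = complex_of_real (d i)" if "i < n" for i
  proof -
    have "mat_adjoint C $$ (i, i) = cnj (C $$ (i, i))" using that C by simp
    then show ?thesis using CH by (simp add: d_def complex_eq_iff)
  qed
  then have "C = mat_diag n (\<lambda>i. complex_of_real (d i))"
    using C dec by (intro eq_matI) (auto simp: mat_diag_def C_def[symmetric])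
  moreover have "U * C * mat_adjoint U = (U * mat_adjoint U) * A * (U * mat_adjoint U)"
    unfolding C_def using U A by (simp add: sq_mult[where n=n])
  then have "A = U * C * mat_adjoint U" using unitary_matD[OF U(2,1)] A by simp
  ultimately show ?thesis using that U by blast
qed

section \<open>Functional calculus, inverses and square roots\<close>

text \<open>For unitary \<open>U\<close> this is the functional calculus of the matrices diagonalised by \<open>U\<close>: products,
  inverses, square roots and suprema with a scalar are computed on the function \<open>f\<close>.\<close>

definition spec_mat :: "nat \<Rightarrow> complex mat \<Rightarrow> (nat \<Rightarrow> real) \<Rightarrow> complex mat" where
  "spec_mat n U f = U * mat_diag n (\<lambda>i. complex_of_real (f i)) * mat_adjoint U"

lemma mat_diag_in_carrier [simp]: "mat_diag n f \<in> carrier_mat n n"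
  by (simp add: mat_diag_def)

lemma spec_mat_carrier [simp]: "U \<in> carrier_mat n n \<Longrightarrow> spec_mat n U f \<in> carrier_mat n n"
  by (simp add: spec_mat_def sq_mult[where n=n])

lemma mat_diag_real_adjoint:
  "mat_adjoint (mat_diag n (\<lambda>i. complex_of_real (f i))) = mat_diag n (\<lambda>i. complex_of_real (f i))"
  by (rule eq_matI) (auto simp: mat_diag_def)

lemma spec_mat_adjoint:
  "U \<in> carrier_mat n n \<Longrightarrow> mat_adjoint (spec_mat n U f) = spec_mat n U f"
  by (simp add: spec_mat_def sq_mult[where n=n] mat_diag_real_adjoint)

lemma mult_mat_zero_vec: "A \<in> carrier_mat n n \<Longrightarrow> A *\<^sub>v 0\<^sub>v n = (0\<^sub>v n :: complex vec)"
  by (rule eq_vecI) auto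

lemma cancel_left_mat:
  fixes A B X :: "complex mat"
  assumes "A * B = 1\<^sub>m n" "A \<in> carrier_mat n n" "B \<in> carrier_mat n n" "X \<in> carrier_mat n n"
  shows "A * (B * X) = X"
  using assms(1) assoc_mult_mat[OF assms(2-4)] assms by (metis left_mult_one_mat)

lemma cancel_left_mat_vec:
  fixes A B :: "complex mat"
  assumes "A * B = 1\<^sub>m n" "A \<in> carrier_mat n n" "B \<in> carrier_mat n n" "v \<in> carrier_vec n"
  shows "A *\<^sub>v (B *\<^sub>v v) = v"
  using assms(1) assoc_mult_mat_vec[OF assms(2-4)] assms by (metis one_mult_mat_vec)

lemma spec_mat_mult:
  assumes "unitary_mat U" "U \<in> carrier_mat n n"
  shows "spec_mat n U f * spec_mat n U g = spec_mat n U (\<lambda>i. f i * g i)"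
proof -
  have "mat_diag n (\<lambda>i. complex_of_real (f i)) * (mat_diag n (\<lambda>i. complex_of_real (g i)) * X) =
     mat_diag n (\<lambda>i. complex_of_real (f i) * complex_of_real (g i)) * X" if "X \<in> carrier_mat n n" for X
    using that by (subst assoc_mult_mat[symmetric, of _ n n _ n _ n]) auto
  then show ?thesis using assms unitary_matD[OF assms]
    by (simp add: spec_mat_def sq_mult[where n=n] cancel_left_mat[of _ _ n])
qed

lemma spec_mat_one:
  assumes "unitary_mat U" "U \<in> carrier_mat n n"
  shows "spec_mat n U (\<lambda>i. 1) = 1\<^sub>m n"
  using assms unitary_matD[OF assms] by (simp add: spec_mat_def)

lemma spec_mat_cong:
  "(\<And>i. i < n \<Longrightarrow> f i = g i) \<Longrightarrow> spec_mat n U f = spec_mat n U g"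
  unfolding spec_mat_def
  by (rule arg_cong[of _ _ "\<lambda>D. U * D * mat_adjoint U"]) (auto simp: mat_diag_def)

lemma hermitian_spec_mat:
  fixes A :: "complex mat"
  assumes "A \<in> carrier_mat n n" "mat_adjoint A = A"
  obtains U d where "U \<in> carrier_mat n n" "unitary_mat U" "A = spec_mat n U d"
  using spectral_theorem[OF assms] unfolding spec_mat_def by blast

lemma qform_spec_mat:
  assumes "U \<in> carrier_mat n n" "v \<in> carrier_vec n"
  shows "qform (spec_mat n U f) v = (\<Sum>i<n. f i * (cmod ((mat_adjoint U *\<^sub>v v) $ i))\<^sup>2)"
proof -
  define w where "w = mat_adjoint U *\<^sub>v v"
  have w: "w \<in> carrier_vec n" using assms unfolding w_def by (metis mat_adjoint_carrier mult_mat_vec_carrier)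
  have "qform (spec_mat n U f) v = qform (mat_diag n (\<lambda>i. complex_of_real (f i))) w"
    using qform_congruence[of "mat_diag n (\<lambda>i. complex_of_real (f i))" n "mat_adjoint U" v] assms
    by (simp add: spec_mat_def w_def)
  also have "(mat_diag n (\<lambda>i. complex_of_real (f i)) *\<^sub>v w) = vec n (\<lambda>i. complex_of_real (f i) * w $ i)"
    by (rule eq_vecI)
      (use w in \<open>auto simp: mat_diag_def scalar_prod_def if_distrib[of "\<lambda>x. x * _"] cong: if_cong\<close>)
  then have "qform (mat_diag n (\<lambda>i. complex_of_real (f i))) w =
      Re (\<Sum>i<n. complex_of_real (f i) * (w $ i * cnj (w $ i)))"
    using w by (simp add: qform_def scalar_prod_def lessThan_atLeast0 mult.assoc)
  also have "\<dots> = (\<Sum>i<n. f i * (cmod (w $ i))\<^sup>2)"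
    by (simp add: complex_norm_square[symmetric] del: of_real_power flip: of_real_mult)
  finally show ?thesis by (simp add: w_def)
qed

lemma adjoint_mult_vec_nonzero:
  assumes "unitary_mat U" "U \<in> carrier_mat n n" "v \<in> carrier_vec n" "v \<noteq> 0\<^sub>v n"
  shows "mat_adjoint U *\<^sub>v v \<noteq> 0\<^sub>v n"
proof
  assume "mat_adjoint U *\<^sub>v v = 0\<^sub>v n"
  then have "U *\<^sub>v (mat_adjoint U *\<^sub>v v) = 0\<^sub>v n" using assms by auto
  moreover have "U *\<^sub>v (mat_adjoint U *\<^sub>v v) = (U * mat_adjoint U) *\<^sub>v v"
    using assms by (simp add: assoc_mult_mat_vec[of _ n n _ n])
  ultimately show False using assms unitary_matD[OF assms(1,2)] by simp
qed

lemma spec_mat_posdef: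
  assumes "unitary_mat U" "U \<in> carrier_mat n n" "\<And>i. i < n \<Longrightarrow> f i > 0"
  shows "spec_mat n U f \<in> posdef_mats n"
proof (rule posdef_matsI)
  fix v :: "complex vec" assume v: "v \<in> carrier_vec n" "v \<noteq> 0\<^sub>v n"
  let ?w = "mat_adjoint U *\<^sub>v v"
  have "\<exists>i<n. ?w $ i \<noteq> 0"
  proof (rule ccontr)
    assume "\<not> ?thesis"
    then have "?w = 0\<^sub>v n" using assms(2) by (intro eq_vecI) auto
    then show False using adjoint_mult_vec_nonzero[OF assms(1,2) v] by simp
  qed
  then obtain k where k: "k < n" "?w $ k \<noteq> 0" by blast
  have "(\<Sum>i<n. f i * (cmod (?w $ i))\<^sup>2) > 0"
    by (rule sum_pos2[of _ k]) (use k assms(3) in \<open>auto simp: less_imp_le\<close>)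
  then show "qform (spec_mat n U f) v > 0" using assms v by (simp add: qform_spec_mat)
qed (use assms in \<open>auto simp: spec_mat_adjoint\<close>)

lemma adjoint_mult_col:
  assumes "unitary_mat U" "U \<in> carrier_mat n n" "i < n"
  shows "mat_adjoint U *\<^sub>v col U i = unit_vec n i"
proof -
  have "mat_adjoint U *\<^sub>v col U i = col (mat_adjoint U * U) i"
    using col_mult2[OF mat_adjoint_carrier[OF assms(2)] assms(2,3)] ..
  then show ?thesis using unitary_matD[OF assms(1,2)] assms by simp
qed

lemma qform_spec_mat_col:
  assumes "unitary_mat U" "U \<in> carrier_mat n n" "i < n"
  shows "qform (spec_mat n U f) (col U i) = f i"
proof -
  have "qform (spec_mat n U f) (col U i) = (\<Sum>j<n. f j * (cmod (unit_vec n i $ j))\<^sup>2)"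
    using qform_spec_mat[OF assms(2), of "col U i" f] adjoint_mult_col[OF assms] assms by simp
  also have "\<dots> = (\<Sum>j<n. if j = i then f j else 0)"
    by (rule sum.cong) (use assms in \<open>auto simp: unit_vec_def\<close>)
  also have "\<dots> = f i" using assms by simp
  finally show ?thesis .
qed

lemma col_unitary_nonzero:
  assumes "unitary_mat U" "U \<in> carrier_mat n n" "i < n"
  shows "col U i \<noteq> 0\<^sub>v n"
proof
  assume "col U i = 0\<^sub>v n"
  moreover have "mat_adjoint U *\<^sub>v 0\<^sub>v n = 0\<^sub>v n" using assms by (intro eq_vecI) auto
  ultimately have "unit_vec n i = (0\<^sub>v n :: complex vec)"
    using adjoint_mult_col[OF assms] by simp
  then show False using assms by (metis index_unit_vec(2) index_zero_vec(1) zero_neq_one)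
qed

lemma posdef_spec_mat:
  assumes "A \<in> posdef_mats n"
  obtains U d where "U \<in> carrier_mat n n" "unitary_mat U" "A = spec_mat n U d" "\<And>i. i < n \<Longrightarrow> d i > 0"
proof -
  note A = posdef_matsD[OF assms]
  obtain U d where U: "U \<in> carrier_mat n n" "unitary_mat U" "A = spec_mat n U d"
    using hermitian_spec_mat[OF A(1,2)] by blast
  have "d i > 0" if "i < n" for i
    using A(3)[of "col U i"] qform_spec_mat_col[OF U(2,1) that, of d] col_unitary_nonzero[OF U(2,1) that] U that
    by simp
  with U that show ?thesis by blast
qed

lemma posdef_sqrt_inverse_exists:
  assumes "A \<in> posdef_mats n"
  obtains R S where "R \<in> posdef_mats n" "S \<in> posdef_mats n" "R * R = A" "R * S = 1\<^sub>m n" "S * R = 1\<^sub>m n"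
proof -
  obtain U d where U: "U \<in> carrier_mat n n" "unitary_mat U" "A = spec_mat n U d" "\<And>i. i < n \<Longrightarrow> d i > 0"
    using posdef_spec_mat[OF assms] by metis
  let ?R = "spec_mat n U (\<lambda>i. sqrt (d i))" and ?S = "spec_mat n U (\<lambda>i. 1 / sqrt (d i))"
  have "?R * ?R = A" unfolding spec_mat_mult[OF U(2,1)] U(3)
    using U(4) by (intro spec_mat_cong) (simp add: less_imp_le)
  moreover have "spec_mat n U (\<lambda>i. sqrt (d i) * (1 / sqrt (d i))) = spec_mat n U (\<lambda>i. 1)"
    using U(4) by (intro spec_mat_cong) (metis less_irrefl nonzero_mult_div_cancel_left mult_1_right real_sqrt_eq_zero_cancel_iff times_divide_eq_right)
  then have "?R * ?S = 1\<^sub>m n" "?S * ?R = 1\<^sub>m n"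
    unfolding spec_mat_mult[OF U(2,1)] spec_mat_one[OF U(2,1)] by (simp_all add: mult.commute)
  moreover have "?R \<in> posdef_mats n" "?S \<in> posdef_mats n"
    using U by (auto intro!: spec_mat_posdef)
  ultimately show ?thesis using that by blast
qed

lemma posdef_inverse_exists:
  assumes "A \<in> posdef_mats n"
  obtains L where "L \<in> posdef_mats n" "A * L = 1\<^sub>m n" "L * A = 1\<^sub>m n"
proof -
  obtain U d where U: "U \<in> carrier_mat n n" "unitary_mat U" "A = spec_mat n U d" "\<And>i. i < n \<Longrightarrow> d i > 0"
    using posdef_spec_mat[OF assms] by metis
  let ?L = "spec_mat n U (\<lambda>i. 1 / d i)"
  have "spec_mat n U (\<lambda>i. d i * (1 / d i)) = spec_mat n U (\<lambda>i. 1)"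
    using U(4) by (intro spec_mat_cong) (metis less_irrefl nonzero_mult_div_cancel_left mult_1_right times_divide_eq_right)
  then have "A * ?L = 1\<^sub>m n" "?L * A = 1\<^sub>m n"
    unfolding spec_mat_mult[OF U(2,1)] spec_mat_one[OF U(2,1)] U(3) by (simp_all add: mult.commute)
  moreover have "?L \<in> posdef_mats n"
    using U by (auto intro!: spec_mat_posdef)
  ultimately show ?thesis using that by blast
qed

lemma posdef_congruence:
  assumes "A \<in> posdef_mats n" "C \<in> carrier_mat n n" "D \<in> carrier_mat n n" "D * C = 1\<^sub>m n"
  shows "mat_adjoint C * A * C \<in> posdef_mats n"
proof (rule posdef_matsI)
  note A = posdef_matsD[OF assms(1)]
  show "mat_adjoint C * A * C \<in> carrier_mat n n" using A assms by (simp add: sq_mult[where n=n])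
  show "mat_adjoint (mat_adjoint C * A * C) = mat_adjoint C * A * C"
    using A assms by (simp add: sq_mult[where n=n])
  fix v :: "complex vec" assume v: "v \<in> carrier_vec n" "v \<noteq> 0\<^sub>v n"
  have "D *\<^sub>v (C *\<^sub>v v) = v" using assms v by (simp add: cancel_left_mat_vec)
  then have "C *\<^sub>v v \<noteq> 0\<^sub>v n" using v assms mult_mat_zero_vec[OF assms(3)] by metis
  moreover have "C *\<^sub>v v \<in> carrier_vec n" using assms v by simp
  ultimately show "qform (mat_adjoint C * A * C) v > 0"
    using A assms v by (simp add: qform_congruence)
qed

lemma posdef_smult:
  assumes "A \<in> posdef_mats n" "c > 0"
  shows "complex_of_real c \<cdot>\<^sub>m A \<in> posdef_mats n"
proof (rule posdef_matsI)
  note A = posdef_matsD[OF assms(1)]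
  show "complex_of_real c \<cdot>\<^sub>m A \<in> carrier_mat n n" using A by simp
  show "mat_adjoint (complex_of_real c \<cdot>\<^sub>m A) = complex_of_real c \<cdot>\<^sub>m A"
    using A by (simp add: mat_adjoint_smult)
  show "qform (complex_of_real c \<cdot>\<^sub>m A) v > 0" if "v \<in> carrier_vec n" "v \<noteq> 0\<^sub>v n" for v
    using A(3)[OF that] assms(2) A that by (simp add: qform_smult)
qed

lemma posdef_one: "1\<^sub>m n \<in> posdef_mats n"
proof (rule posdef_matsI)
  show "qform (1\<^sub>m n) v > 0" if "v \<in> carrier_vec n" "v \<noteq> 0\<^sub>v n" for v
    using cscalar_prod_pos[OF that] that by (simp add: qform_def)
qed auto

text \<open>If \<open>R\<^sup>2 = S\<^sup>2\<close> then \<open>D = R - S\<close> satisfies \<open>R D = - D S\<close>, so \<open>D\<close> maps an eigenvector of \<open>S\<close> for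
  \<open>\<mu> > 0\<close> either to zero or to an eigenvector of \<open>R\<close> for \<open>-\<mu>\<close>, and the spectrum of \<open>R\<close> excludes the
  latter. Hence \<open>D\<close> vanishes on all eigenvectors of \<open>S\<close>, and these span because \<open>S\<close> is similar to a
  positive definite matrix.\<close>

lemma square_root_unique:
  fixes R S Q Q' X :: "complex mat"
  assumes R: "R \<in> carrier_mat n n" "spectrum R \<subseteq> complex_of_real ` {0<..}"
    and X: "X \<in> posdef_mats n" and Q: "Q \<in> carrier_mat n n" "Q' \<in> carrier_mat n n" "Q * Q' = 1\<^sub>m n" "Q' * Q = 1\<^sub>m n"
    and S: "S = Q * X * Q'" and eq: "R * R = S * S"
  shows "R = S"
proof -
  obtain U d where U: "U \<in> carrier_mat n n" "unitary_mat U" "X = spec_mat n U d" "\<And>i. i < n \<Longrightarrow> d i > 0"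
    using posdef_spec_mat[OF X] by metis
  have XC: "X \<in> carrier_mat n n" using U by simp
  have SC: "S \<in> carrier_mat n n" unfolding S using Q XC by (simp add: sq_mult[where n=n])
  define D where "D = R - S"
  have DC: "D \<in> carrier_mat n n" using R SC by (simp add: D_def minus_carrier_mat)
  define V where "V = Q * U"
  have VC: "V \<in> carrier_mat n n" using Q U by (simp add: V_def)
  let ?E = "mat_diag n (\<lambda>i. complex_of_real (d i))"
  have SV: "S * V = V * ?E"
    using Q U XC unitary_matD[OF U(2,1)]
    by (simp add: S V_def spec_mat_def sq_mult[where n=n] cancel_left_mat[of _ _ n] right_mult_one_mat[of _ n n])
  have RD: "R * D = - (D * S)"
  proof -
    have "R * D + D * S = 0\<^sub>m n n" 
      using R SC eq by (simp add: D_def sq_distrib[where n=n]) (rule eq_matI, auto)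
    then have "(R * D + D * S) $$ (i, j) = 0" if "i < n" "j < n" for i j using that by simp
    then show ?thesis using R DC SC
      by (intro eq_matI) (auto simp: eq_neg_iff_add_eq_0)
  qed
  have DV: "D * V = 0\<^sub>m n n"
  proof (rule eq_matI)
    fix i j assume "i < dim_row (0\<^sub>m n n :: complex mat)" "j < dim_col (0\<^sub>m n n :: complex mat)"
    then have ij: "i < n" "j < n" by auto
    let ?w = "col (D * V) j"
    have wC: "?w \<in> carrier_vec n" using DC by (intro carrier_vecI) simp
    have "R * (D * V) = R * D * V" using R DC VC by simp
    also have "\<dots> = - (D * (V * ?E))" unfolding RD using DC SC VC SV by simp
    also have "D * (V * ?E) = (D * V) * ?E" using DC VC by (simp add: assoc_mult_mat[of _ n n _ n _ n])
    finally have RDV: "R * (D * V) = - (D * V * ?E)" .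
    have "R *\<^sub>v ?w = col (R * (D * V)) j"
      using R DC VC ij by (simp add: col_mult2[of _ n n _ n] sq_mult[where n=n])
    also have "\<dots> = - complex_of_real (d j) \<cdot>\<^sub>v ?w"
      unfolding RDV using DC VC ij by (intro eq_vecI) (auto simp: mat_diag_mult_right[of _ n] )
    finally have "R *\<^sub>v ?w = - complex_of_real (d j) \<cdot>\<^sub>v ?w" .
    then have "?w \<noteq> 0\<^sub>v n \<Longrightarrow> - complex_of_real (d j) \<in> spectrum R"
      using wC R by (auto simp: spectrum_def eigenvalue_def eigenvector_def)
    moreover have "- complex_of_real (d j) \<notin> spectrum R"
    proof
      assume "- complex_of_real (d j) \<in> spectrum R"
      then obtain x where "x > 0" "complex_of_real (- d j) = complex_of_real x" using R(2) by auto
      then show False using U(4)[OF ij(2)] unfolding of_real_eq_iff by simp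
    qed
    ultimately have "?w = 0\<^sub>v n" by blast
    moreover have "(D * V) $$ (i, j) = ?w $ i" using DC VC ij by simp
    ultimately show "(D * V) $$ (i, j) = 0\<^sub>m n n $$ (i, j)" using ij by simp
  qed (use DC VC in auto)
  have "V * (mat_adjoint U * Q') = 1\<^sub>m n"
    using Q U unitary_matD[OF U(2,1)] by (simp add: V_def sq_mult[where n=n] cancel_left_mat[of _ _ n])
  moreover have "(D * V) * (mat_adjoint U * Q') = D * (V * (mat_adjoint U * Q'))"
    using DC VC U Q by (simp add: sq_mult[where n=n])
  ultimately have "D = 0\<^sub>m n n * (mat_adjoint U * Q')" using DC DV by simp
  then have "D = 0\<^sub>m n n" using U Q by simp
  then have "D $$ (i, j) = 0" if "i < n" "j < n" for i j using that by simp
  then show ?thesis using R SC unfolding D_def by (intro eq_matI) auto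
qed

lemma spectrum_similar_posdef:
  fixes Q Q' X :: "complex mat"
  assumes X: "X \<in> posdef_mats n" and Q: "Q \<in> carrier_mat n n" "Q' \<in> carrier_mat n n" "Q * Q' = 1\<^sub>m n" "Q' * Q = 1\<^sub>m n"
  shows "spectrum (Q * X * Q') \<subseteq> complex_of_real ` {0<..}"
proof
  fix e assume "e \<in> spectrum (Q * X * Q')"
  moreover note XD = posdef_matsD[OF X]
  ultimately obtain x where x: "x \<in> carrier_vec n" "x \<noteq> 0\<^sub>v n" "(Q * X * Q') *\<^sub>v x = e \<cdot>\<^sub>v x"
    using Q by (auto simp: spectrum_def eigenvalue_def eigenvector_def)
  define y where "y = Q' *\<^sub>v x"
  have y: "y \<in> carrier_vec n" using Q x by (simp add: y_def)
  have "Q *\<^sub>v y = x" using Q x by (simp add: y_def cancel_left_mat_vec)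
  then have y0: "y \<noteq> 0\<^sub>v n" using x Q by auto
  have "X *\<^sub>v y = (Q' * (Q * X * Q')) *\<^sub>v x"
    using Q x XD by (simp add: y_def assoc_mult_mat_vec[of _ n n _ n] sq_mult[where n=n] cancel_left_mat[of _ _ n])
  also have "\<dots> = Q' *\<^sub>v (e \<cdot>\<^sub>v x)"
    using Q x XD by (subst assoc_mult_mat_vec[of _ n n _ n]) (auto simp: sq_mult[where n=n])
  also have "\<dots> = e \<cdot>\<^sub>v y" using Q x by (simp add: y_def mult_mat_vec[of _ n n])
  finally have Xy: "X *\<^sub>v y = e \<cdot>\<^sub>v y" .
  let ?q = "y \<bullet>c y"
  have q: "Re ?q > 0" "Im ?q = 0"
    using cscalar_prod_pos[OF y y0] cscalar_prod_self[OF y] by auto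
  have e1: "(X *\<^sub>v y) \<bullet>c y = e * ?q" using y by (simp add: Xy cscalar_prod_smult_left[of _ n])
  have "(X *\<^sub>v y) \<bullet>c y = y \<bullet>c (X *\<^sub>v y)"
    using cscalar_prod_adjoint[OF XD(1) y y] XD(2) by simp
  also have "\<dots> = cnj e * ?q" using y by (simp add: Xy cscalar_prod_smult_right[of _ n])
  finally have "e * ?q = cnj e * ?q" using e1 by simp
  then have "e = cnj e" using q(1) by auto
  then have Im: "Im e = 0" by (simp add: complex_eq_iff)
  have "Re (e * ?q) > 0" using XD(3)[OF y y0] e1 by (simp add: qform_def)
  then have "Re e > 0" using q Im by (simp add: zero_less_mult_iff)
  then show "e \<in> complex_of_real ` {0<..}" using Im
    by (intro image_eqI[of _ _ "Re e"]) (auto simp: complex_eq_iff)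
qed

lemma spectrum_posdef:
  assumes "X \<in> posdef_mats n"
  shows "spectrum X \<subseteq> complex_of_real ` {0<..}"
  using spectrum_similar_posdef[OF assms, of "1\<^sub>m n" "1\<^sub>m n"] posdef_matsD(1)[OF assms] by simp

lemma principal_sqrt_eqI:
  fixes Q Q' X :: "complex mat"
  assumes X: "X \<in> posdef_mats n" and Q: "Q \<in> carrier_mat n n" "Q' \<in> carrier_mat n n" "Q * Q' = 1\<^sub>m n" "Q' * Q = 1\<^sub>m n"
    and S: "S = Q * X * Q'" "S * S = M"
  shows "principal_sqrt M = S"
proof -
  have SC: "S \<in> carrier_mat n n" using S Q posdef_matsD(1)[OF X] by (simp add: sq_mult[where n=n])
  then have dim: "dim_row M = n" using S(2) by auto
  have positive: "spectrum S \<subseteq> complex_of_real ` {0<..}"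
    unfolding S(1) by (rule spectrum_similar_posdef[OF X Q])
  show ?thesis unfolding principal_sqrt_def dim
  proof (rule the_equality)
    show "S \<in> carrier_mat n n \<and> S * S = M \<and> spectrum S \<subseteq> complex_of_real ` {0<..}"
      using SC S(2) positive by blast
    show "R = S" if "R \<in> carrier_mat n n \<and> R * R = M \<and> spectrum R \<subseteq> complex_of_real ` {0<..}" for R
      using square_root_unique[OF _ _ X Q S(1), of R] that S(2) by simp
  qed
qed

lemma posdef_sqrt_eqI:
  assumes "R \<in> posdef_mats n" "R * R = P"
  shows "posdef_sqrt P = R"
proof -
  have dim: "dim_row P = n" using posdef_matsD(1)[OF assms(1)] assms(2) by auto
  have "R' = R" if "R' \<in> posdef_mats n" "R' * R' = P" for R'
  proof (rule square_root_unique)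
    show "R = 1\<^sub>m n * R * 1\<^sub>m n" using posdef_matsD(1)[OF assms(1)] by simp
    show "R' * R' = R * R" using that assms by simp
  qed (use assms(1) posdef_matsD(1)[OF that(1)] spectrum_posdef[OF that(1)] in simp_all)
  then show ?thesis unfolding posdef_sqrt_def dim using assms by (intro the_equality) blast+
qed

lemma mat_inv_eqI:
  fixes A B :: "complex mat"
  assumes "A \<in> carrier_mat n n" "B \<in> carrier_mat n n" "A * B = 1\<^sub>m n" "B * A = 1\<^sub>m n"
  shows "mat_inv A = B"
proof -
  have "A \<in> Units (ring_mat TYPE(complex) n ())"
    using assms by (auto simp: Units_def ring_mat_def)
  then obtain B' where B': "mat_inverse A = Some B'"
    using mat_inverse(1)[OF assms(1), where b = "()"] by (cases "mat_inverse A") auto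
  then have "A * B' = 1\<^sub>m n" "B' \<in> carrier_mat n n" using mat_inverse(2)[OF assms(1)] by auto
  then have "B' = B" using assms cancel_left_mat[of B A n B'] by simp
  then show ?thesis using B' by (simp add: mat_inv_def)
qed

section \<open>The geometric mean and the principal square root\<close>

text \<open>The geometric mean is handled through the matrix \<open>Z = A\<^sup>-\<^sup>1 (A \<sharp> B)\<close>. It transports \<open>A\<close> to \<open>B\<close> by
  congruence, and what singles it out among all such \<open>Z\<close> is that \<open>A Z\<close> is positive definite. This
  is the Riccati equation \<open>G A\<^sup>-\<^sup>1 G = B\<close> for the mean \<open>G\<close>, written without inverses.\<close>

lemma geometric_mean_transport:
  assumes A: "A \<in> posdef_mats n" and B: "B \<in> posdef_mats n"
  obtains Z where "Z \<in> carrier_mat n n" "A * Z = A \<sharp> B" "A \<sharp> B \<in> posdef_mats n"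
    "mat_adjoint Z * A * Z = B"
proof -
  obtain R S where RS: "R \<in> posdef_mats n" "S \<in> posdef_mats n" "R * R = A" "R * S = 1\<^sub>m n" "S * R = 1\<^sub>m n"
    by (rule posdef_sqrt_inverse_exists[OF A])
  note R = posdef_matsD(1,2)[OF RS(1)] and S = posdef_matsD(1,2)[OF RS(2)]
    and BC = posdef_matsD(1,2)[OF B]
  have "S * B * S \<in> posdef_mats n"
    using posdef_congruence[OF B S(1) R(1) RS(4)] S(2) by simp
  then obtain X where X: "X \<in> posdef_mats n" "X * X = S * B * S"
    by (rule posdef_sqrt_inverse_exists)
  note XC = posdef_matsD(1,2)[OF X(1)]
  have mean: "A \<sharp> B = R * X * R"
    using posdef_sqrt_eqI[OF RS(1,3)] mat_inv_eqI[OF R(1) S(1) RS(4,5)] posdef_sqrt_eqI[OF X]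
    by (simp only: geometric_mean_def Let_def)
  note cancel = cancel_left_mat[OF RS(4) R(1) S(1)] cancel_left_mat[OF RS(5) S(1) R(1)]
  define Z where "Z = S * X * R"
  have ZC: "Z \<in> carrier_mat n n" using R S XC by (simp add: Z_def sq_mult[where n=n])
  have AZ: "A * Z = R * X * R"
    unfolding Z_def RS(3)[symmetric]
    using R(1) S(1) XC(1) by (simp add: sq_mult[where n=n] cancel)
  have "mat_adjoint Z * A * Z = R * (X * X) * R"
    unfolding Z_def RS(3)[symmetric]
    using R S XC by (simp add: sq_mult[where n=n] cancel)
  also have "\<dots> = B" unfolding X(2)
    using R(1) S(1) BC(1) RS(4,5) by (simp add: sq_mult[where n=n] cancel right_mult_one_mat[of _ n n])
  finally have "mat_adjoint Z * A * Z = B" .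
  moreover have "A \<sharp> B \<in> posdef_mats n"
    unfolding mean using posdef_congruence[OF X(1) R(1) S(1) RS(5)] R(2) by simp
  ultimately show ?thesis using that ZC AZ mean by simp
qed

text \<open>The counterpart for the principal square roots: here \<open>A\<close> is transported to \<open>B\<close> by a matrix \<open>H\<close>
  which is itself positive definite, and \<open>(A H)\<^sup>2 = A (H A H) = A B\<close>. With \<open>R = A\<^bsup>1/2\<^esup>\<close> one takes
  \<open>H = R\<^sup>-\<^sup>1 (R B R)\<^bsup>1/2\<^esup> R\<^sup>-\<^sup>1\<close>; then \<open>A H\<close> and \<open>H A\<close> are similar to \<open>(R B R)\<^bsup>1/2\<^esup>\<close>, which gives the
  positive spectrum.\<close>

lemma principal_sqrt_transport:
  assumes A: "A \<in> posdef_mats n" and B: "B \<in> posdef_mats n"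
  obtains H where "H \<in> posdef_mats n" "H * A * H = B"
    "principal_sqrt (A * B) = A * H" "principal_sqrt (B * A) = H * A"
proof -
  obtain R S where RS: "R \<in> posdef_mats n" "S \<in> posdef_mats n" "R * R = A" "R * S = 1\<^sub>m n" "S * R = 1\<^sub>m n"
    by (rule posdef_sqrt_inverse_exists[OF A])
  note R = posdef_matsD(1,2)[OF RS(1)] and S = posdef_matsD(1,2)[OF RS(2)]
    and AC = posdef_matsD(1,2)[OF A] and BC = posdef_matsD(1,2)[OF B]
  have "R * B * R \<in> posdef_mats n"
    using posdef_congruence[OF B R(1) S(1) RS(5)] R(2) by simp
  then obtain Y where Y: "Y \<in> posdef_mats n" "Y * Y = R * B * R"
    by (rule posdef_sqrt_inverse_exists)
  note YC = posdef_matsD(1,2)[OF Y(1)]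
  note cancel = cancel_left_mat[OF RS(4) R(1) S(1)] cancel_left_mat[OF RS(5) S(1) R(1)]
  define H where "H = S * Y * S"
  have HP: "H \<in> posdef_mats n"
    unfolding H_def using posdef_congruence[OF Y(1) S(1) R(1) RS(4)] S(2) by simp
  note HC = posdef_matsD(1,2)[OF HP]
  have AH: "A * H = R * Y * S" "H * A = S * Y * R"
    unfolding H_def RS(3)[symmetric]
    using R(1) S(1) YC(1) by (simp_all add: sq_mult[where n=n] cancel)
  have "H * A * H = S * (Y * Y) * S"
    unfolding AH(2) unfolding H_def
    using R(1) S(1) YC(1) by (simp add: sq_mult[where n=n] cancel)
  also have "\<dots> = B" unfolding Y(2)
    using R(1) S(1) BC(1) RS(4,5) by (simp add: sq_mult[where n=n] cancel right_mult_one_mat[of _ n n])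
  finally have HAH: "H * A * H = B" .
  have "A * H * (A * H) = A * (H * A * H)" "H * A * (H * A) = H * A * H * A"
    using HC(1) AC(1) by (simp_all add: sq_mult[where n=n])
  then have sq: "A * H * (A * H) = A * B" "H * A * (H * A) = B * A" unfolding HAH by auto
  have "principal_sqrt (A * B) = A * H"
    by (rule principal_sqrt_eqI[OF Y(1) R(1) S(1) RS(4,5) AH(1) sq(1)])
  moreover have "principal_sqrt (B * A) = H * A"
    by (rule principal_sqrt_eqI[OF Y(1) S(1) R(1) RS(5,4) AH(2) sq(2)])
  ultimately show ?thesis using that HP HAH by blast
qed

lemma loewner_le_congruence:
  assumes "loewner_le n A B" "A \<in> carrier_mat n n" "B \<in> carrier_mat n n" "C \<in> carrier_mat n n"
  shows "loewner_le n (mat_adjoint C * A * C) (mat_adjoint C * B * C)"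
  using assms by (simp add: loewner_le_def qform_congruence)

text \<open>Positivity of a Hermitian \<open>D\<close> may be tested on the eigenvectors of the pencil \<open>(D, P)\<close>, because
  these correspond to the eigenvectors of the congruent matrix \<open>P\<^bsup>-1/2\<^esup> D P\<^bsup>-1/2\<^esup>\<close>.\<close>

lemma qform_ge_0_of_pencil:
  assumes P: "P \<in> posdef_mats n" and D: "D \<in> carrier_mat n n" "mat_adjoint D = D"
    and ev: "\<And>u m. u \<in> carrier_vec n \<Longrightarrow> u \<noteq> 0\<^sub>v n \<Longrightarrow> D *\<^sub>v u = complex_of_real m \<cdot>\<^sub>v (P *\<^sub>v u) \<Longrightarrow> m \<ge> 0"
    and v: "v \<in> carrier_vec n"
  shows "qform D v \<ge> 0"
proof -
  obtain R S where RS: "R \<in> posdef_mats n" "S \<in> posdef_mats n" "R * R = P" "R * S = 1\<^sub>m n" "S * R = 1\<^sub>m n"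
    by (rule posdef_sqrt_inverse_exists[OF P])
  note R = posdef_matsD(1,2)[OF RS(1)] and S = posdef_matsD(1,2)[OF RS(2)]
  note cancel = cancel_left_mat[OF RS(4) R(1) S(1)] cancel_left_mat[OF RS(5) S(1) R(1)]
  have C: "S * D * S \<in> carrier_mat n n" "mat_adjoint (S * D * S) = S * D * S"
    using S D by (simp_all add: sq_mult[where n=n])
  obtain U d where U: "U \<in> carrier_mat n n" "unitary_mat U" "S * D * S = spec_mat n U d"
    using hermitian_spec_mat[OF C] by blast
  have UU: "U * mat_adjoint U = 1\<^sub>m n" "mat_adjoint U * U = 1\<^sub>m n" using unitary_matD[OF U(2,1)] by auto
  have "d i \<ge> 0" if i: "i < n" for i
  proof (rule ev)
    let ?w = "col U i"
    have w: "?w \<in> carrier_vec n" using U i by auto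
    show "S *\<^sub>v ?w \<in> carrier_vec n" using S w by simp
    have "R *\<^sub>v (S *\<^sub>v ?w) = ?w" using cancel_left_mat_vec[OF RS(4) R(1) S(1) w] .
    then show "S *\<^sub>v ?w \<noteq> 0\<^sub>v n"
      using col_unitary_nonzero[OF U(2,1) i] mult_mat_zero_vec[OF R(1)] by auto
    have "(S * D * S) *\<^sub>v ?w = U *\<^sub>v (mat_diag n (\<lambda>i. complex_of_real (d i)) *\<^sub>v (mat_adjoint U *\<^sub>v ?w))"
      unfolding U(3) spec_mat_def using U(1) w by (simp add: sq_mult[where n=n] assoc_mult_mat_vec[of _ n n _ n])
    also have "mat_adjoint U *\<^sub>v ?w = unit_vec n i" by (rule adjoint_mult_col[OF U(2,1) i])
    also have "mat_diag n (\<lambda>i. complex_of_real (d i)) *\<^sub>v unit_vec n i = complex_of_real (d i) \<cdot>\<^sub>v unit_vec n i"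
      by (rule eq_vecI) (use i in \<open>auto simp: mat_diag_def scalar_prod_right_unit\<close>)
    also have "U *\<^sub>v (complex_of_real (d i) \<cdot>\<^sub>v unit_vec n i) = complex_of_real (d i) \<cdot>\<^sub>v (U *\<^sub>v unit_vec n i)"
      using U(1) by (simp add: mult_mat_vec[of _ n n])
    also have "U *\<^sub>v unit_vec n i = ?w"
      by (rule eq_vecI) (use U(1) i in \<open>auto simp: scalar_prod_right_unit\<close>)
    finally have SDS: "(S * D * S) *\<^sub>v ?w = complex_of_real (d i) \<cdot>\<^sub>v ?w" .
    have "D *\<^sub>v (S *\<^sub>v ?w) = R *\<^sub>v ((S * D * S) *\<^sub>v ?w)"
      using R(1) S(1) D(1) w
      by (simp add: sq_mult[where n=n] assoc_mult_mat_vec[of _ n n _ n] cancel_left_mat_vec[OF RS(4) R(1) S(1)])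
    also have "\<dots> = complex_of_real (d i) \<cdot>\<^sub>v (R *\<^sub>v ?w)"
      unfolding SDS using R(1) w by (simp add: mult_mat_vec[of _ n n])
    also have "R *\<^sub>v ?w = P *\<^sub>v (S *\<^sub>v ?w)"
      unfolding RS(3)[symmetric] using R(1) S(1) w by (simp add: cancel_left_mat_vec[OF RS(4) R(1) S(1)])
    finally show "D *\<^sub>v (S *\<^sub>v ?w) = complex_of_real (d i) \<cdot>\<^sub>v (P *\<^sub>v (S *\<^sub>v ?w))" .
  qed
  then have "qform (spec_mat n U d) (R *\<^sub>v v) \<ge> 0"
    using U(1) R(1) v by (subst qform_spec_mat) (auto intro!: sum_nonneg)
  moreover have "qform (spec_mat n U d) (R *\<^sub>v v) = qform (R * (S * D * S) * R) v"
    using qform_congruence[OF C(1) R(1) v] R(2) U(3) by simp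
  moreover have "R * (S * D * S) * R = D"
    using R(1) S(1) D(1) RS(4,5) by (simp add: sq_mult[where n=n] cancel right_mult_one_mat[of _ n n])
  ultimately show ?thesis by simp
qed

text \<open>Joint monotonicity of the geometric mean. Evaluating \<open>A \<ge> 0\<close> at \<open>Z u - Z' u\<close> and using the two
  order hypotheses gives \<open>Re \<langle>D u, Z' u\<rangle> \<ge> 0\<close> for \<open>D = A' Z' - A Z\<close> and all \<open>u\<close>, a Lyapunov
  inequality. At an eigenvector \<open>D u = \<mu> A' u\<close> of the pencil it reads \<open>\<mu> \<langle>A' Z' u, u\<rangle> \<ge> 0\<close>, so
  \<open>\<mu> \<ge> 0\<close>.\<close>

lemma loewner_le_mean:
  assumes A: "A \<in> posdef_mats n" and A': "A' \<in> posdef_mats n"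
    and Z: "Z \<in> carrier_mat n n" "Z' \<in> carrier_mat n n"
    and G: "mat_adjoint (A * Z) = A * Z" and G': "A' * Z' \<in> posdef_mats n"
    and leA: "loewner_le n A A'"
    and leB: "loewner_le n (mat_adjoint Z * A * Z) (mat_adjoint Z' * A' * Z')"
  shows "loewner_le n (A * Z) (A' * Z')"
proof -
  note AC = posdef_matsD(1,2)[OF A] and AC' = posdef_matsD(1,2)[OF A'] and GC' = posdef_matsD(1,2)[OF G']
  have GC: "A * Z \<in> carrier_mat n n" using AC Z by simp
  define D where "D = A' * Z' - A * Z"
  have D: "D \<in> carrier_mat n n" "mat_adjoint D = D"
    using GC GC' G by (simp_all add: D_def mat_adjoint_minus[of _ n n] minus_carrier_mat)
  have key: "Re ((D *\<^sub>v u) \<bullet>c (Z' *\<^sub>v u)) \<ge> 0" if u: "u \<in> carrier_vec n" for u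
  proof -
    define x y where "x = Z *\<^sub>v u" and "y = Z' *\<^sub>v u"
    have xy: "x \<in> carrier_vec n" "y \<in> carrier_vec n" using Z u by (auto simp: x_def y_def)
    have Axy: "A *\<^sub>v x \<in> carrier_vec n" "A *\<^sub>v y \<in> carrier_vec n" "A' *\<^sub>v y \<in> carrier_vec n"
      using AC(1) AC'(1) xy by auto
    have yx: "(A *\<^sub>v y) \<bullet>c x = cnj ((A *\<^sub>v x) \<bullet>c y)"
      using cscalar_prod_adjoint[OF AC(1) xy(2,1)] AC(2) cscalar_prod_commute[OF Axy(1) xy(2)] by simp
    have "0 \<le> qform A (x - y)" using qform_posdef_ge_0[OF A] xy by simp
    also have "qform A (x - y) = qform A x + qform A y - 2 * Re ((A *\<^sub>v x) \<bullet>c y)"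
      using AC(1) xy Axy yx
      by (simp add: qform_def mult_minus_distrib_mat_vec[of _ n n] cscalar_prod_minus_left[of _ n]
          cscalar_prod_minus_right[of _ n])
    also have "qform A x = qform (mat_adjoint Z * A * Z) u"
      using qform_congruence[OF AC(1) Z(1) u] by (simp add: x_def)
    also have "\<dots> \<le> qform (mat_adjoint Z' * A' * Z') u" using leB u by (simp add: loewner_le_def)
    also have "\<dots> = qform A' y"
      using qform_congruence[OF AC'(1) Z(2) u] by (simp add: y_def)
    also have "qform A y \<le> qform A' y" using leA xy by (simp add: loewner_le_def)
    finally have "Re ((A' *\<^sub>v y) \<bullet>c y) - Re ((A *\<^sub>v x) \<bullet>c y) \<ge> 0" by (simp add: qform_def)
    moreover have "D *\<^sub>v u = A' *\<^sub>v y - A *\<^sub>v x"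
      unfolding D_def x_def y_def using AC(1) AC'(1) Z u
      by (simp add: minus_mult_distrib_mat_vec[of _ n n] sq_mult[where n=n])
    ultimately show ?thesis using Axy xy
      by (simp add: cscalar_prod_minus_left[of _ n] flip: y_def)
  qed
  have "qform D v \<ge> 0" if v: "v \<in> carrier_vec n" for v
  proof (rule qform_ge_0_of_pencil[OF A' D _ v])
    fix u m assume u: "u \<in> carrier_vec n" "u \<noteq> 0\<^sub>v n" and Du: "D *\<^sub>v u = complex_of_real m \<cdot>\<^sub>v (A' *\<^sub>v u)"
    have Zu: "Z' *\<^sub>v u \<in> carrier_vec n" "A' *\<^sub>v u \<in> carrier_vec n" using Z u AC' by auto
    have "(A' *\<^sub>v u) \<bullet>c (Z' *\<^sub>v u) = u \<bullet>c (A' *\<^sub>v (Z' *\<^sub>v u))"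
      using cscalar_prod_adjoint[OF AC'(1) u(1) Zu(1)] AC'(2) by simp
    also have "\<dots> = u \<bullet>c ((A' * Z') *\<^sub>v u)" using AC'(1) Z u by simp
    also have "\<dots> = cnj (((A' * Z') *\<^sub>v u) \<bullet>c u)"
      using GC' u by (intro cscalar_prod_commute[of _ n]) auto
    finally have "Re ((A' *\<^sub>v u) \<bullet>c (Z' *\<^sub>v u)) = qform (A' * Z') u" by (simp add: qform_def)
    then have "m * qform (A' * Z') u \<ge> 0"
      using key[OF u(1)] Zu by (simp add: Du cscalar_prod_smult_left[of _ n])
    then show "m \<ge> 0" using posdef_matsD(3)[OF G' u] by (simp add: zero_le_mult_iff)
  qed
  moreover have "qform (A' * Z') v = qform D v + qform (A * Z) v" if "v \<in> carrier_vec n" for v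
  proof -
    have "A' * Z' = D + A * Z" using AC(1) AC'(1) Z unfolding D_def by (intro eq_matI) auto
    then show ?thesis using qform_add[OF D(1) GC that] by simp
  qed
  ultimately show ?thesis by (simp add: loewner_le_def)
qed

section \<open>Traces\<close>

definition re_trace :: "nat \<Rightarrow> complex mat \<Rightarrow> real" where
  "re_trace n A = (\<Sum>i<n. Re (A $$ (i, i)))"

lemma re_trace_add:
  "A \<in> carrier_mat n n \<Longrightarrow> B \<in> carrier_mat n n \<Longrightarrow> re_trace n (A + B) = re_trace n A + re_trace n B"
  by (simp add: re_trace_def sum.distrib)

lemma re_trace_minus:
  "A \<in> carrier_mat n n \<Longrightarrow> B \<in> carrier_mat n n \<Longrightarrow> re_trace n (A - B) = re_trace n A - re_trace n B"
  by (simp add: re_trace_def sum_subtractf)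

lemma re_trace_smult:
  "A \<in> carrier_mat n n \<Longrightarrow> re_trace n (complex_of_real c \<cdot>\<^sub>m A) = c * re_trace n A"
  by (simp add: re_trace_def sum_distrib_left)

lemma re_trace_mult_commute:
  assumes "A \<in> carrier_mat n n" "B \<in> carrier_mat n n"
  shows "re_trace n (A * B) = re_trace n (B * A)"
proof -
  have "(\<Sum>i<n. (A * B) $$ (i, i)) = (\<Sum>i<n. \<Sum>j<n. A $$ (i, j) * B $$ (j, i))"
    using assms by (auto simp: scalar_prod_def lessThan_atLeast0)
  also have "\<dots> = (\<Sum>j<n. \<Sum>i<n. A $$ (i, j) * B $$ (j, i))" by (rule sum.swap)
  also have "\<dots> = (\<Sum>j<n. (B * A) $$ (j, j))"
    using assms by (auto simp: scalar_prod_def lessThan_atLeast0 mult.commute)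
  finally show ?thesis unfolding re_trace_def by (simp only: Re_sum[symmetric])
qed

lemma qform_col:
  assumes "X \<in> carrier_mat n n" "U \<in> carrier_mat n n" "i < n"
  shows "qform X (col U i) = Re ((mat_adjoint U * X * U) $$ (i, i))"
proof -
  have "X *\<^sub>v col U i = col (X * U) i" using col_mult2[OF assms] ..
  moreover have "(mat_adjoint U * X * U) $$ (i, i) = (mat_adjoint U * (X * U)) $$ (i, i)"
    using assms by (simp add: sq_mult[where n=n])
  moreover have "\<dots> = col (X * U) i \<bullet>c col U i"
    using assms by (auto simp: scalar_prod_def mult.commute intro!: sum.cong)
  ultimately show ?thesis by (simp add: qform_def)
qed

lemma sum_qform_col:
  assumes "X \<in> carrier_mat n n" "U \<in> carrier_mat n n" "unitary_mat U"
  shows "(\<Sum>i<n. qform X (col U i)) = re_trace n X"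
proof -
  have "(\<Sum>i<n. qform X (col U i)) = re_trace n (mat_adjoint U * (X * U))"
    using assms by (simp add: re_trace_def qform_col sq_mult[where n=n])
  also have "\<dots> = re_trace n (X * U * mat_adjoint U)"
    using assms by (intro re_trace_mult_commute) auto
  also have "X * U * mat_adjoint U = X"
    using assms unitary_matD[OF assms(3,2)] by (simp add: sq_mult[where n=n])
  finally show ?thesis .
qed

lemma re_trace_nonneg:
  assumes "X \<in> carrier_mat n n" "\<And>v. v \<in> carrier_vec n \<Longrightarrow> qform X v \<ge> 0"
  shows "re_trace n X \<ge> 0"
proof -
  have "unitary_mat (1\<^sub>m n)" by (rule unitary_matI[of _ n]) auto
  then have "re_trace n X = (\<Sum>i<n. qform X (col (1\<^sub>m n) i))"
    using sum_qform_col[OF assms(1), of "1\<^sub>m n"] by simp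
  then show ?thesis using assms(2) by (auto intro!: sum_nonneg)
qed

lemma re_trace_spec_mat:
  assumes "U \<in> carrier_mat n n" "unitary_mat U"
  shows "re_trace n (spec_mat n U f) = (\<Sum>i<n. f i)"
  using sum_qform_col[of "spec_mat n U f" n U] assms by (simp add: qform_spec_mat_col)

text \<open>Among the Hermitian \<open>A Z\<close> with \<open>Z\<^sup>* A Z = H A H\<close>, the trace is dominated by that of \<open>A H\<close>: expanding the
  nonnegative number \<open>tr (H\<^sup>-\<^sup>1 (H - Z)\<^sup>* A (H - Z))\<close> gives exactly \<open>2 tr (A H) - 2 tr (A Z)\<close>.\<close>

lemma re_trace_mean_le:
  assumes A: "A \<in> posdef_mats n" and H: "H \<in> posdef_mats n" and Z: "Z \<in> carrier_mat n n"
    and G: "mat_adjoint (A * Z) = A * Z" and eq: "mat_adjoint Z * A * Z = H * A * H"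
  shows "re_trace n (A * Z) \<le> re_trace n (H * A)"
proof -
  note AC = posdef_matsD(1,2)[OF A] and HC = posdef_matsD(1,2)[OF H]
  obtain L where L: "L \<in> posdef_mats n" "H * L = 1\<^sub>m n" "L * H = 1\<^sub>m n"
    by (rule posdef_inverse_exists[OF H])
  note LC = posdef_matsD(1,2)[OF L(1)]
  obtain Q where Q: "Q \<in> posdef_mats n" "Q * Q = L"
    by (rule posdef_sqrt_inverse_exists[OF L(1)])
  note QC = posdef_matsD(1,2)[OF Q(1)]
  note cancel = cancel_left_mat[OF L(2) HC(1) LC(1)] cancel_left_mat[OF L(3) LC(1) HC(1)]
  define E where "E = H - Z"
  have EC: "E \<in> carrier_mat n n" using HC Z by (simp add: E_def minus_carrier_mat)
  define T where "T = mat_adjoint E * A * E"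
  have TC: "T \<in> carrier_mat n n" using EC AC by (simp add: T_def sq_mult[where n=n])
  have "0 \<le> re_trace n (Q * T * Q)"
  proof (rule re_trace_nonneg)
    show "Q * T * Q \<in> carrier_mat n n" using QC TC by (simp add: sq_mult[where n=n])
    fix v :: "complex vec" assume v: "v \<in> carrier_vec n"
    have "qform (Q * T * Q) v = qform A (E *\<^sub>v (Q *\<^sub>v v))"
      using qform_congruence[OF TC QC(1) v] qform_congruence[OF AC(1) EC, of "Q *\<^sub>v v"] QC v
      by (simp add: T_def)
    then show "qform (Q * T * Q) v \<ge> 0" using qform_posdef_ge_0[OF A] EC QC v by simp
  qed
  also have "re_trace n (Q * T * Q) = re_trace n (Q * (Q * T))"
    using re_trace_mult_commute[of "Q * T" n Q] QC TC by simp
  also have "Q * (Q * T) = L * T" unfolding Q(2)[symmetric] using QC TC by (simp add: sq_mult[where n=n])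
  finally have pos: "re_trace n (L * T) \<ge> 0" .
  have ZA: "mat_adjoint Z * A = A * Z" using G AC Z by (simp add: sq_mult[where n=n])
  have LHAH: "L * (mat_adjoint Z * A * Z) = A * H"
    unfolding eq using AC HC LC by (simp add: sq_mult[where n=n] cancel)
  have "T = (H * (A * H) - mat_adjoint Z * A * H) - (H * (A * Z) - mat_adjoint Z * A * Z)"
    unfolding T_def E_def using AC HC Z
    by (simp add: sq_mult[where n=n] sq_distrib[where n=n])
  then have "L * T = (A * H - L * (A * Z * H)) - (A * Z - L * (mat_adjoint Z * A * Z))"
    unfolding ZA using AC HC Z LC
    by (simp add: sq_mult[where n=n] sq_distrib[where n=n] cancel)
  then have LT: "L * T = (A * H - L * (A * Z * H)) - (A * Z - A * H)"
    unfolding LHAH .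
  have "re_trace n (L * (A * Z * H)) = re_trace n (A * Z * H * L)"
    using AC HC Z LC by (intro re_trace_mult_commute) (simp_all add: sq_mult[where n=n])
  also have "A * Z * H * L = A * Z"
    using AC HC Z LC L(2) by (simp add: sq_mult[where n=n] right_mult_one_mat[of _ n n])
  finally have "re_trace n (L * T) = 2 * re_trace n (A * H) - 2 * re_trace n (A * Z)"
    unfolding LT using AC HC Z LC
    by (simp add: re_trace_minus sq_mult[where n=n] minus_carrier_mat)
  then show ?thesis using pos re_trace_mult_commute[OF AC(1) HC(1)] by simp
qed

section \<open>Comparison of the two matrices\<close>

text \<open>Both sides of the theorem have this shape, with the same \<open>A\<close> and \<open>B\<close>: they differ only in whether
  \<open>C\<close> is \<open>2 (A \<sharp> B)\<close> or \<open>(AB)\<^bsup>1/2\<^esup> + (BA)\<^bsup>1/2\<^esup>\<close>.\<close>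

definition quad_comb :: "real \<Rightarrow> real \<Rightarrow> complex mat \<Rightarrow> complex mat \<Rightarrow> complex mat \<Rightarrow> complex mat" where
  "quad_comb a b A B C = complex_of_real (a\<^sup>2) \<cdot>\<^sub>m A + complex_of_real (b\<^sup>2) \<cdot>\<^sub>m B
     + complex_of_real (a * b) \<cdot>\<^sub>m C"

lemma quad_comb_carrier [simp]:
  "A \<in> carrier_mat n n \<Longrightarrow> B \<in> carrier_mat n n \<Longrightarrow> C \<in> carrier_mat n n \<Longrightarrow> quad_comb a b A B C \<in> carrier_mat n n"
  by (simp add: quad_comb_def)

lemma quad_comb_adjoint:
  assumes "A \<in> carrier_mat n n" "B \<in> carrier_mat n n" "C \<in> carrier_mat n n"
    "mat_adjoint A = A" "mat_adjoint B = B" "mat_adjoint C = C"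
  shows "mat_adjoint (quad_comb a b A B C) = quad_comb a b A B C"
  using assms by (simp add: quad_comb_def mat_adjoint_add[of _ n n] mat_adjoint_smult del: of_real_mult of_real_power)

lemma qform_quad_comb:
  assumes "A \<in> carrier_mat n n" "B \<in> carrier_mat n n" "C \<in> carrier_mat n n" "v \<in> carrier_vec n"
  shows "qform (quad_comb a b A B C) v = a\<^sup>2 * qform A v + b\<^sup>2 * qform B v + a * b * qform C v"
  using assms by (simp add: quad_comb_def qform_add[of _ n] qform_smult[of _ n] del: of_real_mult of_real_power)

lemma re_trace_quad_comb:
  assumes "A \<in> carrier_mat n n" "B \<in> carrier_mat n n" "C \<in> carrier_mat n n"
  shows "re_trace n (quad_comb a b A B C) = a\<^sup>2 * re_trace n A + b\<^sup>2 * re_trace n B + a * b * re_trace n C"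
  using assms by (simp add: quad_comb_def re_trace_add re_trace_smult del: of_real_mult of_real_power)

lemma quad_comb_expand:
  assumes "X \<in> carrier_mat n n" "P \<in> carrier_mat n n" "Q \<in> carrier_mat n n" "V \<in> carrier_mat n n"
  shows "complex_of_real a \<cdot>\<^sub>m (complex_of_real a \<cdot>\<^sub>m X + complex_of_real b \<cdot>\<^sub>m P)
      + complex_of_real b \<cdot>\<^sub>m (complex_of_real a \<cdot>\<^sub>m Q + complex_of_real b \<cdot>\<^sub>m V)
    = quad_comb a b X V (P + Q)"
  unfolding quad_comb_def using assms
  by (intro eq_matI) (auto simp: algebra_simps power2_eq_square)

text \<open>The reason why \<open>W_mat a b A B\<close> is a congruence of \<open>A\<close>: with \<open>B = H A H\<close> and \<open>X = A\<close> the right-hand side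
  is that matrix.\<close>

lemma affine_congruence:
  assumes H: "H \<in> carrier_mat n n" and X: "X \<in> carrier_mat n n"
    and K: "K = complex_of_real a \<cdot>\<^sub>m 1\<^sub>m n + complex_of_real b \<cdot>\<^sub>m H"
  shows "K * X * K = quad_comb a b X (H * X * H) (X * H + H * X)"
proof -
  have KC: "K \<in> carrier_mat n n" using H by (simp add: K)
  have L: "K * Y = complex_of_real a \<cdot>\<^sub>m Y + complex_of_real b \<cdot>\<^sub>m (H * Y)" if "Y \<in> carrier_mat n n" for Y
    using H that by (simp add: K sq_distrib[where n=n])
  have "X * K = complex_of_real a \<cdot>\<^sub>m X + complex_of_real b \<cdot>\<^sub>m (X * H)"
    using H X by (simp add: K sq_distrib[where n=n] right_mult_one_mat[of _ n n])
  moreover have "K * X * K = K * (X * K)" using KC X by (simp add: sq_mult[where n=n])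
  ultimately have "K * X * K = complex_of_real a \<cdot>\<^sub>m (complex_of_real a \<cdot>\<^sub>m X + complex_of_real b \<cdot>\<^sub>m (X * H))
      + complex_of_real b \<cdot>\<^sub>m (complex_of_real a \<cdot>\<^sub>m (H * X) + complex_of_real b \<cdot>\<^sub>m (H * X * H))"
    using H X L by (simp add: sq_mult[where n=n] sq_distrib[where n=n])
  also have "\<dots> = quad_comb a b X (H * X * H) (X * H + H * X)"
    using H X by (intro quad_comb_expand[of _ n]) (simp_all add: sq_mult[where n=n])
  finally show ?thesis .
qed

lemma qform_one: "v \<in> carrier_vec n \<Longrightarrow> qform (1\<^sub>m n) v = Re (v \<bullet>c v)"
  by (simp add: qform_def)

lemma posdef_affine:
  assumes H: "H \<in> posdef_mats n" and ab: "a \<ge> 0" "b \<ge> 0" "a > 0 \<or> b > 0"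
  shows "complex_of_real a \<cdot>\<^sub>m 1\<^sub>m n + complex_of_real b \<cdot>\<^sub>m H \<in> posdef_mats n"
proof (rule posdef_matsI)
  note HC = posdef_matsD[OF H]
  show "complex_of_real a \<cdot>\<^sub>m 1\<^sub>m n + complex_of_real b \<cdot>\<^sub>m H \<in> carrier_mat n n" using HC by simp
  show "mat_adjoint (complex_of_real a \<cdot>\<^sub>m 1\<^sub>m n + complex_of_real b \<cdot>\<^sub>m H)
      = complex_of_real a \<cdot>\<^sub>m 1\<^sub>m n + complex_of_real b \<cdot>\<^sub>m H"
    using HC by (simp add: mat_adjoint_add[of _ n n] mat_adjoint_smult)
  fix v :: "complex vec" assume v: "v \<in> carrier_vec n" "v \<noteq> 0\<^sub>v n"
  have "qform (complex_of_real a \<cdot>\<^sub>m 1\<^sub>m n + complex_of_real b \<cdot>\<^sub>m H) v = a * qform (1\<^sub>m n) v + b * qform H v"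
    using HC(1) v by (simp add: qform_add[of _ n] qform_smult[of _ n])
  moreover have "qform (1\<^sub>m n) v > 0" "qform H v > 0"
    using posdef_matsD(3)[OF posdef_one v] HC(3)[OF v] by auto
  ultimately show "qform (complex_of_real a \<cdot>\<^sub>m 1\<^sub>m n + complex_of_real b \<cdot>\<^sub>m H) v > 0"
    using ab by (metis add_nonneg_pos add_pos_nonneg less_imp_le mult_nonneg_nonneg mult_pos_pos)
qed

text \<open>The heart of the argument. Replacing the spectrum of \<open>W = K A K\<close> by \<open>max (d i) t\<close> enlarges \<open>W\<close> to
  some \<open>W'\<close>, and the data \<open>A' = K\<^sup>-\<^sup>1 W' K\<^sup>-\<^sup>1\<close>, \<open>B' = H A' H\<close> belong to \<open>W'\<close> as \<open>A\<close>, \<open>B\<close> belong to \<open>W\<close>. By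
  monotonicity of the mean, the left-hand side \<open>M'\<close> formed from \<open>A'\<close>, \<open>B'\<close> lies above the one
  formed from \<open>A\<close>, \<open>B\<close>. It also lies above \<open>t\<close>: for the scalar matrix \<open>t\<close> in place of \<open>W\<close> everything
  commutes with \<open>H\<close>, the two sides of the theorem agree, and monotonicity applies to \<open>t \<le> W'\<close>. Finally the
  trace inequality for means bounds the trace of \<open>M'\<close> by that of \<open>W'\<close>.\<close>

lemma mean_majorant:
  assumes A: "A \<in> posdef_mats n" and B: "B \<in> posdef_mats n" and H: "H \<in> posdef_mats n" "H * A * H = B"
    and ab: "a \<ge> 0" "b \<ge> 0" "a > 0 \<or> b > 0" and t: "t > 0"
    and U: "U \<in> carrier_mat n n" "unitary_mat U" "quad_comb a b A B (A * H + H * A) = spec_mat n U d"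
  obtains M' where "M' \<in> carrier_mat n n"
    "loewner_le n (quad_comb a b A B (complex_of_real 2 \<cdot>\<^sub>m (A \<sharp> B))) M'"
    "loewner_le n (complex_of_real t \<cdot>\<^sub>m 1\<^sub>m n) M'"
    "re_trace n M' \<le> (\<Sum>i<n. max (d i) t)"
proof -
  note AC = posdef_matsD(1,2)[OF A] and BC = posdef_matsD(1,2)[OF B] and HC = posdef_matsD(1,2)[OF H(1)]
  define K where "K = complex_of_real a \<cdot>\<^sub>m 1\<^sub>m n + complex_of_real b \<cdot>\<^sub>m H"
  have KP: "K \<in> posdef_mats n" unfolding K_def by (rule posdef_affine[OF H(1) ab])
  note KC = posdef_matsD(1,2)[OF KP]
  obtain L where L: "L \<in> posdef_mats n" "K * L = 1\<^sub>m n" "L * K = 1\<^sub>m n"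
    by (rule posdef_inverse_exists[OF KP])
  note LC = posdef_matsD(1,2)[OF L(1)]
  note cancel = cancel_left_mat[OF L(2) KC(1) LC(1)] cancel_left_mat[OF L(3) LC(1) KC(1)]
  define W where "W = K * A * K"
  have W: "W = spec_mat n U d"
    unfolding W_def affine_congruence[OF HC(1) AC(1) K_def] H(2) U(3) ..
  define W' where "W' = spec_mat n U (\<lambda>i. max (d i) t)"
  have W'P: "W' \<in> posdef_mats n" unfolding W'_def by (rule spec_mat_posdef[OF U(2,1)]) (use t in auto)
  note WC' = posdef_matsD(1,2)[OF W'P]
  have WW': "loewner_le n W W'"
    unfolding loewner_le_def W W'_def using U(1) by (auto simp: qform_spec_mat intro!: sum_mono mult_right_mono)
  have tW': "loewner_le n (complex_of_real t \<cdot>\<^sub>m 1\<^sub>m n) W'"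
  proof -
    have "complex_of_real t \<cdot>\<^sub>m 1\<^sub>m n = spec_mat n U (\<lambda>i. t)"
    proof -
      have "mat_diag n (\<lambda>i. complex_of_real t) = complex_of_real t \<cdot>\<^sub>m 1\<^sub>m n"
        by (rule eq_matI) (auto simp: mat_diag_def)
      then show ?thesis using U(1) unitary_matD[OF U(2,1)]
        by (simp add: spec_mat_def sq_distrib[where n=n] right_mult_one_mat[of _ n n])
    qed
    then show ?thesis unfolding loewner_le_def W'_def using U(1)
      by (auto simp: qform_spec_mat intro!: sum_mono mult_right_mono)
  qed
  define A' where "A' = L * W' * L"
  have A'P: "A' \<in> posdef_mats n"
    unfolding A'_def using posdef_congruence[OF W'P LC(1) KC(1) L(2)] LC(2) by simp
  note AC' = posdef_matsD(1,2)[OF A'P]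
  have KA'K: "K * A' * K = W'"
    unfolding A'_def using KC(1) LC(1) WC'(1) L(2,3)
    by (simp add: sq_mult[where n=n] cancel right_mult_one_mat[of _ n n])
  have AA': "loewner_le n A A'"
  proof -
    have "L * W * L = A" unfolding W_def using KC(1) LC(1) AC(1) L(2,3)
      by (simp add: sq_mult[where n=n] cancel right_mult_one_mat[of _ n n])
    moreover have "W \<in> carrier_mat n n" using KC(1) AC(1) by (simp add: W_def sq_mult[where n=n])
    ultimately show ?thesis
      using loewner_le_congruence[OF WW' _ WC'(1) LC(1)] LC(2) by (simp add: A'_def)
  qed
  define B' where "B' = H * A' * H"
  obtain Hi where Hi: "Hi \<in> posdef_mats n" "Hi * H = 1\<^sub>m n" by (rule posdef_inverse_exists[OF H(1)])
  have B'P: "B' \<in> posdef_mats n"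
    unfolding B'_def using posdef_congruence[OF A'P HC(1) posdef_matsD(1)[OF Hi(1)] Hi(2)] HC(2) by simp
  note BC' = posdef_matsD(1,2)[OF B'P]
  have BB': "loewner_le n B B'"
    using loewner_le_congruence[OF AA' AC(1) AC'(1) HC(1)] HC(2) H(2) by (simp add: B'_def)
  obtain Z where Z: "Z \<in> carrier_mat n n" "A * Z = A \<sharp> B" "A \<sharp> B \<in> posdef_mats n" "mat_adjoint Z * A * Z = B"
    by (rule geometric_mean_transport[OF A B])
  obtain Z' where Z': "Z' \<in> carrier_mat n n" "A' * Z' = A' \<sharp> B'" "A' \<sharp> B' \<in> posdef_mats n"
    "mat_adjoint Z' * A' * Z' = B'"
    by (rule geometric_mean_transport[OF A'P B'P])
  note GC = posdef_matsD(1,2)[OF Z(3)] and GC' = posdef_matsD(1,2)[OF Z'(3)]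
  have GG': "loewner_le n (A \<sharp> B) (A' \<sharp> B')"
    using loewner_le_mean[OF A A'P Z(1) Z'(1)] Z Z' GC AA' BB' by simp
  define M' where "M' = quad_comb a b A' B' (complex_of_real 2 \<cdot>\<^sub>m (A' \<sharp> B'))"
  have MC': "M' \<in> carrier_mat n n" using AC' BC' GC' by (simp add: M'_def)
  have abg: "a\<^sup>2 * x + b\<^sup>2 * y + a * b * z \<le> a\<^sup>2 * x' + b\<^sup>2 * y' + a * b * z'"
    if "x \<le> x'" "y \<le> y'" "z \<le> z'" for x y z x' y' z' :: real
    using ab that by (intro add_mono mult_left_mono) auto
  have MM': "loewner_le n (quad_comb a b A B (complex_of_real 2 \<cdot>\<^sub>m (A \<sharp> B))) M'"
    unfolding loewner_le_def M'_def
  proof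
    fix v :: "complex vec" assume v: "v \<in> carrier_vec n"
    show "qform (quad_comb a b A B (complex_of_real 2 \<cdot>\<^sub>m (A \<sharp> B))) v
        \<le> qform (quad_comb a b A' B' (complex_of_real 2 \<cdot>\<^sub>m (A' \<sharp> B'))) v"
      using AC(1) BC(1) GC(1) AC'(1) BC'(1) GC'(1) v AA' BB' GG'
      by (simp add: qform_quad_comb[of _ n] qform_smult[where n = n and c = 2, simplified] loewner_le_def abg)
  qed
  \<comment> \<open>The data that belong to the scalar matrix \<open>t\<close>: since \<open>A0\<close> commutes with \<open>H\<close>, the matrix
    \<open>A0 * H\<close> serves as the mean of \<open>A0\<close> and \<open>H * A0 * H\<close>.\<close>
  define A0 where "A0 = L * (complex_of_real t \<cdot>\<^sub>m 1\<^sub>m n) * L"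
  have tP: "complex_of_real t \<cdot>\<^sub>m 1\<^sub>m n \<in> posdef_mats n" by (rule posdef_smult[OF posdef_one t])
  note tC = posdef_matsD(1,2)[OF tP]
  have A0P: "A0 \<in> posdef_mats n"
    unfolding A0_def using posdef_congruence[OF tP LC(1) KC(1) L(2)] LC(2) by simp
  note AC0 = posdef_matsD(1,2)[OF A0P]
  have A0': "A0 = complex_of_real t \<cdot>\<^sub>m (L * L)"
    unfolding A0_def using LC(1) by (simp add: sq_distrib[where n=n] right_mult_one_mat[of _ n n])
  have HK: "H * K = K * H"
    unfolding K_def using HC(1) by (simp add: sq_distrib[where n=n] right_mult_one_mat[of _ n n])
  have HL: "H * L = L * H"
  proof -
    have "L * H = L * (H * K) * L" using HC(1) KC(1) LC(1) L(2)
      by (simp add: sq_mult[where n=n] right_mult_one_mat[of _ n n])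
    also have "\<dots> = H * L" unfolding HK using HC(1) KC(1) LC(1) L(3)
      by (simp add: sq_mult[where n=n] cancel)
    finally show ?thesis ..
  qed
  have HA0: "H * A0 = A0 * H"
  proof -
    have "H * (L * L) = L * L * H"
    proof -
      have "H * (L * L) = H * L * L" using HC(1) LC(1) by (simp add: sq_mult[where n=n])
      also have "\<dots> = L * H * L" by (simp only: HL)
      also have "\<dots> = L * (H * L)" using HC(1) LC(1) by (simp add: sq_mult[where n=n])
      also have "\<dots> = L * (L * H)" by (simp only: HL)
      also have "\<dots> = L * L * H" using HC(1) LC(1) by (simp add: sq_mult[where n=n])
      finally show ?thesis .
    qed
    then show ?thesis unfolding A0' using HC(1) LC(1)
      by (simp add: sq_distrib[where n=n] sq_mult[where n=n])
  qed
  have A0A': "loewner_le n A0 A'"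
    using loewner_le_congruence[OF tW' tC(1) WC'(1) LC(1)] LC(2) by (simp add: A0_def A'_def)
  have B0B': "loewner_le n (H * A0 * H) B'"
    using loewner_le_congruence[OF A0A' AC0(1) AC'(1) HC(1)] HC(2) by (simp add: B'_def)
  have "mat_adjoint (A0 * H) = A0 * H" using AC0 HC HA0 by (simp add: sq_mult[where n=n])
  then have G0G': "loewner_le n (A0 * H) (A' \<sharp> B')"
    using loewner_le_mean[OF A0P A'P HC(1) Z'(1)] Z' A0A' B0B' HC by simp
  have "K * A0 * K = complex_of_real t \<cdot>\<^sub>m 1\<^sub>m n"
    unfolding A0_def using KC(1) LC(1) L(2,3)
    by (simp add: sq_mult[where n=n] sq_distrib[where n=n] cancel right_mult_one_mat[of _ n n])
  then have t_eq: "complex_of_real t \<cdot>\<^sub>m 1\<^sub>m n = quad_comb a b A0 (H * A0 * H) (A0 * H + A0 * H)"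
    using affine_congruence[OF HC(1) AC0(1) K_def] HA0 by simp
  have tM': "loewner_le n (complex_of_real t \<cdot>\<^sub>m 1\<^sub>m n) M'"
    unfolding loewner_le_def
  proof
    fix v :: "complex vec" assume v: "v \<in> carrier_vec n"
    have C: "H * A0 * H \<in> carrier_mat n n" "A0 * H \<in> carrier_mat n n"
      using HC AC0 by (simp_all add: sq_mult[where n=n])
    have "qform (quad_comb a b A0 (H * A0 * H) (A0 * H + A0 * H)) v \<le> qform M' v"
      using C AC0(1) AC'(1) BC'(1) GC'(1) v A0A' B0B' G0G'
      by (simp add: M'_def qform_quad_comb[of _ n] qform_add[of _ n] qform_smult[where n = n and c = 2, simplified] loewner_le_def abg)
    then show "qform (complex_of_real t \<cdot>\<^sub>m 1\<^sub>m n) v \<le> qform M' v" unfolding t_eq .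
  qed
  have "re_trace n (A' \<sharp> B') \<le> re_trace n (H * A')"
    using re_trace_mean_le[OF A'P H(1) Z'(1)] Z' GC' by (simp add: B'_def)
  moreover have "re_trace n (A' * H) = re_trace n (H * A')"
    by (rule re_trace_mult_commute[OF AC'(1) HC(1)])
  moreover have "re_trace n W' = re_trace n (quad_comb a b A' B' (A' * H + H * A'))"
    using affine_congruence[OF HC(1) AC'(1) K_def] KA'K by (simp add: B'_def)
  ultimately have "re_trace n M' \<le> re_trace n W'"
    using AC'(1) BC'(1) GC'(1) HC(1)
    by (simp add: M'_def re_trace_quad_comb re_trace_add re_trace_smult[where c = 2, simplified] mult_left_mono ab)
  also have "re_trace n W' = (\<Sum>i<n. max (d i) t)"
    unfolding W'_def by (rule re_trace_spec_mat[OF U(1,2)])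
  finally show ?thesis using that MC' MM' tM' by blast
qed

section \<open>Ordered eigenvalues and weak majorization\<close>

text \<open>The columns of \<open>U\<close> are permuted along with the eigenvalues; every entry of the product
  \<open>U D U\<^sup>*\<close> is a sum over the columns, which does not depend on their order.\<close>

lemma spec_mat_permute:
  assumes U: "U \<in> carrier_mat n n" "unitary_mat U" and p: "p permutes {..<n}"
  obtains V where "V \<in> carrier_mat n n" "unitary_mat V" "spec_mat n U d = spec_mat n V (d \<circ> p)"
proof -
  define V where "V = mat n n (\<lambda>(i, j). U $$ (i, p j))"
  have pn: "p j < n" if "j < n" for j using permutes_in_image[OF p, of j] that by simp
  have V: "V \<in> carrier_mat n n" by (simp add: V_def)
  have reindex: "(\<Sum>j<n. f (p j)) = (\<Sum>j<n. f j)" for f :: "nat \<Rightarrow> complex"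
    using sum.permute[OF p, of f] by (simp add: o_def)
  have entry: "(X * D * mat_adjoint X) $$ (i, j) = (\<Sum>k<n. X $$ (i, k) * f k * cnj (X $$ (j, k)))"
    if "X \<in> carrier_mat n n" "i < n" "j < n" "D = mat_diag n f" for X D f i j
    using that by (simp add: mat_diag_mult_right[of _ n] scalar_prod_def lessThan_atLeast0)
  have "V * mat_diag n (\<lambda>i. f (p i)) * mat_adjoint V = U * mat_diag n f * mat_adjoint U" for f
  proof (rule eq_matI)
    fix i j assume "i < dim_row (U * mat_diag n f * mat_adjoint U)" "j < dim_col (U * mat_diag n f * mat_adjoint U)"
    then have ij: "i < n" "j < n" using U(1) by auto
    have "(V * mat_diag n (\<lambda>i. f (p i)) * mat_adjoint V) $$ (i, j)
        = (\<Sum>k<n. U $$ (i, p k) * f (p k) * cnj (U $$ (j, p k)))"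
      unfolding entry[OF V ij refl] by (rule sum.cong) (use ij in \<open>simp_all add: V_def\<close>)
    also have "\<dots> = (U * mat_diag n f * mat_adjoint U) $$ (i, j)"
      unfolding entry[OF U(1) ij refl] by (rule reindex)
    finally show "(V * mat_diag n (\<lambda>i. f (p i)) * mat_adjoint V) $$ (i, j) = (U * mat_diag n f * mat_adjoint U) $$ (i, j)" .
  qed (use U V in auto)
  note key = this
  have one: "mat_diag n (\<lambda>i. 1) = (1\<^sub>m n :: complex mat)" by (rule eq_matI) (auto simp: mat_diag_def)
  have "V * mat_adjoint V = 1\<^sub>m n"
    using key[of "\<lambda>i. 1"] unitary_matD[OF U(2,1)] U V by (simp add: one)
  moreover have "mat_adjoint V * V = 1\<^sub>m n"
    using mat_mult_left_right_inverse[OF V _ calculation] V by simp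
  ultimately have "unitary_mat V" by (rule unitary_matI[OF V])
  moreover have "spec_mat n U d = spec_mat n V (d \<circ> p)"
    using key[of "\<lambda>i. complex_of_real (d i)"] by (simp add: spec_mat_def)
  ultimately show ?thesis using that V by blast
qed

lemma hermitian_spec_mat_decreasing:
  fixes A :: "complex mat"
  assumes "A \<in> carrier_mat n n" "mat_adjoint A = A"
  obtains U d where "U \<in> carrier_mat n n" "unitary_mat U" "A = spec_mat n U d"
    "\<And>i j. i \<le> j \<Longrightarrow> j < n \<Longrightarrow> d j \<le> d i"
proof -
  obtain U d where U: "U \<in> carrier_mat n n" "unitary_mat U" "A = spec_mat n U d"
    using hermitian_spec_mat[OF assms] by blast
  let ?ys = "map d [0..<n]"
  let ?xs = "rev (sort ?ys)"
  obtain p where p: "p permutes {..<length ?ys}" "permute_list p ?ys = ?xs"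
    using mset_eq_permutation[of ?xs ?ys] by auto
  have pn: "p permutes {..<n}" using p(1) by simp
  have "d (p i) = ?xs ! i" if "i < n" for i
    using permute_list_nth[OF p(1), of i] permutes_in_image[OF pn, of i] that p(2) by simp
  moreover have "?xs ! j \<le> ?xs ! i" if "i \<le> j" "j < n" for i j
    using that by (simp add: rev_nth sorted_nth_mono)
  ultimately have "(d \<circ> p) j \<le> (d \<circ> p) i" if "i \<le> j" "j < n" for i j using that by simp
  moreover obtain V where "V \<in> carrier_mat n n" "unitary_mat V" "spec_mat n U d = spec_mat n V (d \<circ> p)"
    by (rule spec_mat_permute[OF U(1,2) pn])
  ultimately show ?thesis using that U(3) by metis
qed

lemma eigvals_decreasing_spec_mat:
  assumes U: "U \<in> carrier_mat n n" "unitary_mat U"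
    and d: "\<And>i j. i \<le> j \<Longrightarrow> j < n \<Longrightarrow> d j \<le> d i"
  shows "eigvals_decreasing (spec_mat n U d) = map d [0..<n]"
proof -
  let ?D = "mat_diag n (\<lambda>i. complex_of_real (d i))"
  have "similar_mat_wit (spec_mat n U d) ?D U (mat_adjoint U)"
    using U unitary_matD[OF U(2,1)] by (auto simp: similar_mat_wit_def Let_def spec_mat_def)
  then have "char_poly (spec_mat n U d) = char_poly ?D"
    by (intro char_poly_similar) (auto simp: similar_mat_def)
  also have "\<dots> = (\<Prod>a\<leftarrow>diag_mat ?D. [:- a, 1:])"
    by (rule char_poly_upper_triangular[of _ n]) (auto simp: upper_triangular_def mat_diag_def)
  also have "diag_mat ?D = map (\<lambda>i. complex_of_real (d i)) [0..<n]"
    by (auto simp: diag_mat_def mat_diag_def)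
  finally have cp: "char_poly (spec_mat n U d)
      = prod_list (map (\<lambda>a. [:- a, 1:]) (map (\<lambda>i. complex_of_real (d i)) [0..<n]))" .
  have pr: "proots (prod_list (map (\<lambda>a. [:- a, 1:]) xs)) = mset xs" for xs :: "complex list"
  proof (induction xs)
    case (Cons x xs)
    have "prod_list (map (\<lambda>a. [:- a, 1:]) xs) \<noteq> 0" by (auto simp: prod_list_zero_iff)
    then show ?case using Cons by (simp add: proots_mult del: mult_pCons_left)
  qed simp
  have "image_mset Re (proots (char_poly (spec_mat n U d))) = mset (map d [0..<n])"
    unfolding cp pr by (simp add: multiset.map_comp o_def)
  moreover have "sorted (rev (map d [0..<n]))"
    by (auto simp: sorted_iff_nth_mono rev_nth intro!: d)
  ultimately have "sorted_list_of_multiset (image_mset Re (proots (char_poly (spec_mat n U d)))) = rev (map d [0..<n])"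
    by (metis mset_rev sorted_list_of_multiset_mset sorted_sort_id)
  then show ?thesis by (simp add: eigvals_decreasing_def)
qed

lemma weakly_majorized_map:
  assumes f: "\<And>i j. i \<le> j \<Longrightarrow> j < n \<Longrightarrow> f j \<le> f i" and g: "\<And>i j. i \<le> j \<Longrightarrow> j < n \<Longrightarrow> g j \<le> g i"
  shows "map f [0..<n] \<prec>\<^sub>w map g [0..<n] \<longleftrightarrow> (\<forall>k\<in>{1..n}. (\<Sum>i<k. f i) \<le> (\<Sum>i<k. g i))"
proof -
  have dec: "decreasing (map h [0..<n]) = map h [0..<n]"
    if "\<And>i j. i \<le> j \<Longrightarrow> j < n \<Longrightarrow> h j \<le> h i" for h
  proof -
    have "sorted (rev (map h [0..<n]))"
      by (auto simp: sorted_iff_nth_mono rev_nth intro!: that)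
    then have "sort (map h [0..<n]) = rev (map h [0..<n])"
      by (intro properties_for_sort) simp_all
    then show ?thesis by (simp add: decreasing_def)
  qed
  have "sum_list (take k (map h [0..<n])) = (\<Sum>i<k. h i)" if "k \<le> n" for h :: "nat \<Rightarrow> real" and k
    using that by (simp add: take_map take_upt sum_list_sum_nth lessThan_atLeast0)
  moreover have "decreasing (map f [0..<n]) = map f [0..<n]" by (rule dec) (rule f)
  moreover have "decreasing (map g [0..<n]) = map g [0..<n]" by (rule dec) (rule g)
  ultimately show ?thesis unfolding weakly_majorized_def by simp
qed

text \<open>The sum of the \<open>k\<close> leading eigenvalues of the smaller matrix is a partial trace in its own
  eigenbasis, so it is at most the corresponding partial trace of \<open>M'\<close>. The other \<open>n - k\<close> diagonal
  entries of \<open>M'\<close> in that basis are at least \<open>t\<close> each, and the full trace is controlled. As \<open>t\<close>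
  separates the first \<open>k\<close> entries of \<open>d\<close> from the others, \<open>max (d i) t\<close> is \<open>d i\<close> up to there and \<open>t\<close>
  afterwards, so that the surplus \<open>(n - k) t\<close> cancels.\<close>

lemma partial_sums_le:
  assumes V: "V \<in> carrier_mat n n" "unitary_mat V" and M': "M' \<in> carrier_mat n n"
    and le: "loewner_le n (spec_mat n V m) M'" "loewner_le n (complex_of_real t \<cdot>\<^sub>m 1\<^sub>m n) M'"
    and tr: "re_trace n M' \<le> (\<Sum>i<n. max (d i) t)"
    and k: "k \<le> n" and d: "\<And>i. i < k \<Longrightarrow> t \<le> d i" "\<And>i. k \<le> i \<Longrightarrow> i < n \<Longrightarrow> d i \<le> t"
  shows "(\<Sum>i<k. m i) \<le> (\<Sum>i<k. d i)"
proof -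
  have split: "(\<Sum>i<n. f i) = (\<Sum>i<k. f i) + (\<Sum>i\<in>{k..<n}. f i)" for f :: "nat \<Rightarrow> real"
    using k by (metis lessThan_atLeast0 sum.atLeastLessThan_concat zero_le)
  have VC: "col V i \<in> carrier_vec n" for i using V by auto
  have "(\<Sum>i<k. m i) = (\<Sum>i<k. qform (spec_mat n V m) (col V i))"
    using k V by (simp add: qform_spec_mat_col)
  also have "\<dots> \<le> (\<Sum>i<k. qform M' (col V i))"
    using le(1) VC by (auto simp: loewner_le_def intro!: sum_mono)
  also have "\<dots> = re_trace n M' - (\<Sum>i\<in>{k..<n}. qform M' (col V i))"
    using sum_qform_col[OF M' V] split[of "\<lambda>i. qform M' (col V i)"] by simp
  also have "\<dots> \<le> (\<Sum>i<n. max (d i) t) - (\<Sum>i\<in>{k..<n}. t)"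
  proof -
    have "t \<le> qform M' (col V i)" if "i < n" for i
    proof -
      have "col V i \<bullet>c col V i = (mat_adjoint V * V) $$ (i, i)"
        using V that by (auto simp: scalar_prod_def mult.commute)
      then have "qform (1\<^sub>m n) (col V i) = 1"
        using unitary_matD[OF V(2,1)] that VC by (simp add: qform_one)
      then have "qform (complex_of_real t \<cdot>\<^sub>m 1\<^sub>m n) (col V i) = t"
        using VC by (simp add: qform_smult[of _ n])
      then show ?thesis using le(2) VC unfolding loewner_le_def by metis
    qed
    then have "(\<Sum>i\<in>{k..<n}. t) \<le> (\<Sum>i\<in>{k..<n}. qform M' (col V i))" by (intro sum_mono) auto
    then show ?thesis using tr by simp
  qed
  also have "\<dots> = (\<Sum>i<k. d i)"
    unfolding split[of "\<lambda>i. max (d i) t"] using d by (simp add: max_absorb1 max_absorb2)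
  finally show ?thesis .
qed

section \<open>Symmetric gauge functions and unitarily invariant norms\<close>

text \<open>The last clause says that only the first \<open>n\<close> entries count, so that vectors of length \<open>n\<close> can be
  represented by functions on all natural numbers. Convexity is what remains of the triangle
  inequality and homogeneity.\<close>

definition symmetric_gauge :: "nat \<Rightarrow> ((nat \<Rightarrow> real) \<Rightarrow> real) \<Rightarrow> bool" where
  "symmetric_gauge n \<Phi> \<longleftrightarrow>
     (\<forall>x y \<theta>. 0 \<le> \<theta> \<longrightarrow> \<theta> \<le> 1 \<longrightarrow> \<Phi> (\<lambda>i. \<theta> * x i + (1 - \<theta>) * y i) \<le> \<theta> * \<Phi> x + (1 - \<theta>) * \<Phi> y) \<and>
     (\<forall>x i. i < n \<longrightarrow> \<Phi> (x(i := - x i)) = \<Phi> x) \<and>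
     (\<forall>x i j. i < n \<longrightarrow> j < n \<longrightarrow> \<Phi> (x \<circ> transpose i j) = \<Phi> x) \<and>
     (\<forall>x y. (\<forall>i<n. x i = y i) \<longrightarrow> \<Phi> x = \<Phi> y)"

lemma symmetric_gaugeD:
  assumes "symmetric_gauge n \<Phi>"
  shows "0 \<le> \<theta> \<Longrightarrow> \<theta> \<le> 1 \<Longrightarrow> \<Phi> (\<lambda>i. \<theta> * x i + (1 - \<theta>) * y i) \<le> \<theta> * \<Phi> x + (1 - \<theta>) * \<Phi> y"
    and "i < n \<Longrightarrow> \<Phi> (x(i := - x i)) = \<Phi> x"
    and "i < n \<Longrightarrow> j < n \<Longrightarrow> \<Phi> (x \<circ> transpose i j) = \<Phi> x"
    and "(\<And>i. i < n \<Longrightarrow> x i = y i) \<Longrightarrow> \<Phi> x = \<Phi> y"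
  using assms unfolding symmetric_gauge_def by blast+

text \<open>The vector with the smaller entry is a convex combination of \<open>y\<close> and of \<open>y\<close> with that entry
  negated.\<close>

lemma gauge_shrink_entry:
  fixes \<Phi> :: "(nat \<Rightarrow> real) \<Rightarrow> real"
  assumes sg: "symmetric_gauge n \<Phi>"
    and i: "i < n" and c: "0 \<le> c" "c \<le> y i"
  shows "\<Phi> (y(i := c)) \<le> \<Phi> y"
proof (cases "y i = 0")
  case True
  then have "y(i := c) = y" using c by (auto simp: fun_eq_iff)
  then show ?thesis by simp
next
  case False
  then have yi: "y i > 0" using c by simp
  define \<theta> where "\<theta> = (1 + c / y i) / 2"
  have \<theta>: "0 \<le> \<theta>" "\<theta> \<le> 1" using c yi by (auto simp: \<theta>_def field_simps)
  have "c = \<theta> * y i + (1 - \<theta>) * - y i" using yi by (simp add: \<theta>_def field_simps)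
  then have "y(i := c) = (\<lambda>j. \<theta> * y j + (1 - \<theta>) * (y(i := - y i)) j)"
    by (auto simp: fun_eq_iff algebra_simps)
  then have "\<Phi> (y(i := c)) \<le> \<theta> * \<Phi> y + (1 - \<theta>) * \<Phi> (y(i := - y i))"
    using symmetric_gaugeD(1)[OF sg \<theta>, of y "y(i := - y i)"] by metis
  then show ?thesis using symmetric_gaugeD(2)[OF sg i] by (simp add: algebra_simps)
qed

lemma gauge_mono:
  fixes \<Phi> :: "(nat \<Rightarrow> real) \<Rightarrow> real"
  assumes sg: "symmetric_gauge n \<Phi>"
    and le: "\<And>i. i < n \<Longrightarrow> 0 \<le> x i" "\<And>i. i < n \<Longrightarrow> x i \<le> y i"
  shows "\<Phi> x \<le> \<Phi> y"
proof -
  have "\<Phi> (\<lambda>i. if i < k then x i else y i) \<le> \<Phi> y" if "k \<le> n" for k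
    using that
  proof (induction k)
    case (Suc k)
    let ?z = "\<lambda>i. if i < k then x i else y i"
    have "(\<lambda>i. if i < Suc k then x i else y i) = ?z(k := x k)"
      by (auto simp: fun_eq_iff less_Suc_eq)
    moreover have "\<Phi> (?z(k := x k)) \<le> \<Phi> ?z"
      by (rule gauge_shrink_entry[OF sg]) (use Suc.prems le in auto)
    ultimately show ?case using Suc by simp
  qed simp
  from this[of n] show ?thesis using symmetric_gaugeD(4)[OF sg, of x "\<lambda>i. if i < n then x i else y i"] by simp
qed

text \<open>A Robin Hood transfer replaces \<open>y\<close> by a convex combination of \<open>y\<close> and of \<open>y\<close> with two entries
  exchanged.\<close>

lemma gauge_transfer:
  fixes \<Phi> :: "(nat \<Rightarrow> real) \<Rightarrow> real"
  assumes sg: "symmetric_gauge n \<Phi>"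
    and ij: "i < n" "j < n" and \<delta>: "0 \<le> \<delta>" "\<delta> \<le> y i - y j" "y j < y i"
  shows "\<Phi> (y(i := y i - \<delta>, j := y j + \<delta>)) \<le> \<Phi> y"
proof -
  define \<theta> where "\<theta> = 1 - \<delta> / (y i - y j)"
  have \<theta>: "0 \<le> \<theta>" "\<theta> \<le> 1" using \<delta> by (auto simp: \<theta>_def field_simps)
  have d: "\<delta> = (1 - \<theta>) * (y i - y j)" using \<delta> by (simp add: \<theta>_def)
  have "y(i := y i - \<delta>, j := y j + \<delta>) = (\<lambda>k. \<theta> * y k + (1 - \<theta>) * (y \<circ> transpose i j) k)"
    using \<delta>(3) unfolding d by (auto simp: fun_eq_iff transpose_def algebra_simps)
  then have "\<Phi> (y(i := y i - \<delta>, j := y j + \<delta>)) \<le> \<theta> * \<Phi> y + (1 - \<theta>) * \<Phi> (y \<circ> transpose i j)"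
    using symmetric_gaugeD(1)[OF sg \<theta>, of y "y \<circ> transpose i j"] by metis
  then show ?thesis using symmetric_gaugeD(3)[OF sg ij] by (simp add: algebra_simps)
qed

text \<open>Induction on the number of indices where \<open>x\<close> and \<open>y\<close> differ. At the first index \<open>j\<close> with \<open>y j < x j\<close>
  the partial sums force an earlier index \<open>i\<close> with \<open>x i < y i\<close>. A transfer from \<open>y i\<close> to \<open>y j\<close>, as
  large as possible without overshooting \<open>x\<close>, settles \<open>i\<close> or \<open>j\<close> and preserves the partial sums,
  because \<open>x \<le> y\<close> before \<open>j\<close>. Leaving \<open>y\<close> unordered spares a rearrangement after each transfer. Once no such
  \<open>j\<close> exists, \<open>x \<le> y\<close> holds entrywise.\<close>

lemma gauge_dominance:
  fixes \<Phi> :: "(nat \<Rightarrow> real) \<Rightarrow> real"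
  assumes sg: "symmetric_gauge n \<Phi>"
    and x: "\<And>i. i < n \<Longrightarrow> 0 \<le> x i" "\<And>i j. i \<le> j \<Longrightarrow> j < n \<Longrightarrow> x j \<le> x i"
    and y: "\<And>i. i < n \<Longrightarrow> 0 \<le> y i"
    and sums: "\<And>k. k \<le> n \<Longrightarrow> (\<Sum>i<k. x i) \<le> (\<Sum>i<k. y i)"
  shows "\<Phi> x \<le> \<Phi> y"
  using y sums
proof (induction "card {i. i < n \<and> x i \<noteq> y i}" arbitrary: y rule: less_induct)
  case less
  show ?case
  proof (cases "\<forall>i<n. x i \<le> y i")
    case True
    then show ?thesis using gauge_mono[OF sg, of x y] x(1) by blast
  next
    case False
    define j where "j = (LEAST j. j < n \<and> y j < x j)"
    have "\<exists>j. j < n \<and> y j < x j" using False by (auto simp: not_le)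
    then have j: "j < n" "y j < x j" unfolding j_def by (metis (mono_tags, lifting) LeastI_ex)+
    have before: "x l \<le> y l" if "l < j" for l
      using not_less_Least[of l "\<lambda>j. j < n \<and> y j < x j"] that j(1) unfolding j_def[symmetric]
      by (auto simp: not_less)
    have "\<exists>i<j. x i < y i"
    proof (rule ccontr)
      assume "\<not> ?thesis"
      then have "(\<Sum>i<j. y i) \<le> (\<Sum>i<j. x i)" by (intro sum_mono) (meson lessThan_iff not_less)
      then have "(\<Sum>i<Suc j. y i) < (\<Sum>i<Suc j. x i)" using j by simp
      then show False using less.prems(2)[of "Suc j"] j by simp
    qed
    then obtain i where i: "i < j" "x i < y i" by blast
    have xij: "x j \<le> x i" using x(2)[of i j] i j by simp
    define \<delta> where "\<delta> = min (y i - x i) (x j - y j)"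
    have \<delta>: "0 < \<delta>" "\<delta> \<le> y i - x i" "\<delta> \<le> x j - y j" using i j by (auto simp: \<delta>_def)
    define y' where "y' = y(i := y i - \<delta>, j := y j + \<delta>)"
    have y'i: "y' i = y i - \<delta>" and y'j: "y' j = y j + \<delta>" and y'l: "\<And>l. l \<noteq> i \<Longrightarrow> l \<noteq> j \<Longrightarrow> y' l = y l"
      using i by (auto simp: y'_def)
    have "{l. l < n \<and> x l \<noteq> y' l} \<subset> {l. l < n \<and> x l \<noteq> y l}"
    proof
      show "{l. l < n \<and> x l \<noteq> y' l} \<subseteq> {l. l < n \<and> x l \<noteq> y l}"
        using i j by (auto simp: y'_def split: if_splits)
      have "x i = y' i \<or> x j = y' j" using y'i y'j by (auto simp: \<delta>_def min_def split: if_splits)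
      then have "i \<notin> {l. l < n \<and> x l \<noteq> y' l} \<or> j \<notin> {l. l < n \<and> x l \<noteq> y' l}" by blast
      moreover have "i \<in> {l. l < n \<and> x l \<noteq> y l}" "j \<in> {l. l < n \<and> x l \<noteq> y l}" using i j by simp_all
      ultimately show "{l. l < n \<and> x l \<noteq> y' l} \<noteq> {l. l < n \<and> x l \<noteq> y l}" by blast
    qed
    then have "card {l. l < n \<and> x l \<noteq> y' l} < card {l. l < n \<and> x l \<noteq> y l}"
      by (intro psubset_card_mono) auto
    moreover have "0 \<le> y' l" if "l < n" for l
    proof -
      consider "l = i" | "l = j" | "l \<noteq> i" "l \<noteq> j" by blast
      then show ?thesis
      proof cases
        case 1
        then show ?thesis using y'i \<delta> x(1)[of i] that by simp
      next
        case 2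
        then show ?thesis using y'j \<delta> less.prems(1)[of j] that by simp
      next
        case 3
        then show ?thesis using y'l less.prems(1)[OF that] by simp
      qed
    qed
    moreover have "(\<Sum>l<k. x l) \<le> (\<Sum>l<k. y' l)" if k: "k \<le> n" for k
    proof -
      have eq: "(\<Sum>l<k. y' l) = (\<Sum>l<k. y l) - (if i < k then \<delta> else 0) + (if j < k then \<delta> else 0)"
      proof -
        have "(\<Sum>l<k. y' l) = (\<Sum>l<k. y l - (if l = i then \<delta> else 0) + (if l = j then \<delta> else 0))"
          using i by (intro sum.cong) (auto simp: y'_def)
        then show ?thesis by (simp add: sum.distrib sum_subtractf)
      qed
      show ?thesis
      proof (cases "i < k \<and> k \<le> j")
        case True
        have "y i - x i \<le> (\<Sum>l<k. y l - x l)"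
          using True before by (intro member_le_sum) auto
        then show ?thesis using True \<delta> eq by (simp add: sum_subtractf)
      next
        case False
        then show ?thesis using eq less.prems(2)[OF k] i by (auto split: if_splits)
      qed
    qed
    ultimately have "\<Phi> x \<le> \<Phi> y'" by (rule less.hyps)
    also have "\<Phi> y' \<le> \<Phi> y"
      unfolding y'_def
      by (rule gauge_transfer[OF sg]) (use i j xij \<delta> in auto)
    finally show ?thesis .
  qed
qed

lemma unitarily_invariant_normD:
  assumes "unitarily_invariant_norm n N" and "X \<in> carrier_mat n n"
  shows "N (c \<cdot>\<^sub>m X) = cmod c * N X"
    "Y \<in> carrier_mat n n \<Longrightarrow> N (X + Y) \<le> N X + N Y"
    "U \<in> carrier_mat n n \<Longrightarrow> V \<in> carrier_mat n n \<Longrightarrow> unitary_mat U \<Longrightarrow> unitary_mat V \<Longrightarrow> N (U * X * V) = N X"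
  using assms unfolding unitarily_invariant_norm_def by blast+

text \<open>Ky Fan dominance for positive semidefinite matrices: by unitary invariance the norm of such a matrix
  is a symmetric gauge function of its eigenvalues. Sign changes and permutations of the eigenvalues
  are realised by unitary matrices.\<close>

lemma fan_dominance_psd:
  assumes N: "unitarily_invariant_norm n N"
    and U: "U \<in> carrier_mat n n" "unitary_mat U" and V: "V \<in> carrier_mat n n" "unitary_mat V"
    and x: "\<And>i. i < n \<Longrightarrow> 0 \<le> x i" "\<And>i j. i \<le> j \<Longrightarrow> j < n \<Longrightarrow> x j \<le> x i"
    and y: "\<And>i. i < n \<Longrightarrow> 0 \<le> y i"
    and sums: "\<And>k. k \<le> n \<Longrightarrow> (\<Sum>i<k. x i) \<le> (\<Sum>i<k. y i)"
  shows "N (spec_mat n U x) \<le> N (spec_mat n V y)"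
proof -
  define \<Phi> where "\<Phi> z = N (mat_diag n (\<lambda>i. complex_of_real (z i)))" for z :: "nat \<Rightarrow> real"
  have N_spec: "N (spec_mat n X z) = \<Phi> z" if "X \<in> carrier_mat n n" "unitary_mat X" for X z
    unfolding spec_mat_def \<Phi>_def
    using unitarily_invariant_normD(3)[OF N _ that(1) _ that(2) unitary_mat_adjoint[OF that(2,1)]] that by simp
  have one: "unitary_mat (1\<^sub>m n)" by (rule unitary_matI[of _ n]) auto
  have "symmetric_gauge n \<Phi>"
    unfolding symmetric_gauge_def
  proof (intro conjI allI impI)
    fix x y :: "nat \<Rightarrow> real" and \<theta> :: real assume \<theta>: "0 \<le> \<theta>" "\<theta> \<le> 1"
    have C: "mat_diag n f \<in> carrier_mat n n" "c \<cdot>\<^sub>m mat_diag n f \<in> carrier_mat n n" for f :: "nat \<Rightarrow> complex" and c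
      by simp_all
    have "mat_diag n (\<lambda>i. complex_of_real (\<theta> * x i + (1 - \<theta>) * y i)) =
       complex_of_real \<theta> \<cdot>\<^sub>m mat_diag n (\<lambda>i. complex_of_real (x i)) + complex_of_real (1 - \<theta>) \<cdot>\<^sub>m mat_diag n (\<lambda>i. complex_of_real (y i))"
      by (rule eq_matI) (auto simp: mat_diag_def)
    then have "\<Phi> (\<lambda>i. \<theta> * x i + (1 - \<theta>) * y i) \<le>
        N (complex_of_real \<theta> \<cdot>\<^sub>m mat_diag n (\<lambda>i. complex_of_real (x i)))
        + N (complex_of_real (1 - \<theta>) \<cdot>\<^sub>m mat_diag n (\<lambda>i. complex_of_real (y i)))"
      unfolding \<Phi>_def by (simp only: unitarily_invariant_normD(2)[OF N C(2) C(2)])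
    also have "\<dots> = \<theta> * \<Phi> x + (1 - \<theta>) * \<Phi> y"
      unfolding \<Phi>_def unitarily_invariant_normD(1)[OF N C(1)] norm_of_real using \<theta> by simp
    finally show "\<Phi> (\<lambda>i. \<theta> * x i + (1 - \<theta>) * y i) \<le> \<theta> * \<Phi> x + (1 - \<theta>) * \<Phi> y" .
  next
    fix x :: "nat \<Rightarrow> real" and i assume i: "i < n"
    define s :: "nat \<Rightarrow> complex" where "s k = (if k = i then -1 else 1)" for k
    have "mat_diag n s * mat_diag n s = 1\<^sub>m n"
      unfolding mat_diag_diag by (rule eq_matI) (auto simp: mat_diag_def s_def)
    moreover have "mat_adjoint (mat_diag n s) = mat_diag n s"
      by (rule eq_matI) (auto simp: mat_diag_def s_def)
    ultimately have "unitary_mat (mat_diag n s)" by (intro unitary_matI[of _ n]) auto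
    then have "N (mat_diag n s * mat_diag n (\<lambda>k. complex_of_real (x k)) * 1\<^sub>m n) = \<Phi> x"
      unfolding \<Phi>_def by (intro unitarily_invariant_normD(3)[OF N]) (auto simp: one)
    moreover have "mat_diag n s * mat_diag n (\<lambda>k. complex_of_real (x k)) * 1\<^sub>m n
        = mat_diag n (\<lambda>k. complex_of_real ((x(i := - x i)) k))"
      by (subst right_mult_one_mat[of _ n n], force, unfold mat_diag_diag, rule eq_matI)
        (auto simp: mat_diag_def s_def)
    ultimately show "\<Phi> (x(i := - x i)) = \<Phi> x" unfolding \<Phi>_def by simp
  next
    fix x :: "nat \<Rightarrow> real" and i j assume ij: "i < n" "j < n"
    then have "transpose i j permutes {..<n}" by (intro permutes_swap_id) auto
    from spec_mat_permute[OF _ one this] obtain V where V: "V \<in> carrier_mat n n" "unitary_mat V"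
      "spec_mat n (1\<^sub>m n) x = spec_mat n V (x \<circ> transpose i j)"
      by (metis one_carrier_mat)
    then show "\<Phi> (x \<circ> transpose i j) = \<Phi> x"
      using N_spec[OF V(1,2)] N_spec[OF _ one, of x] by simp
  next
    fix x y :: "nat \<Rightarrow> real" assume "\<forall>i<n. x i = y i"
    then have "mat_diag n (\<lambda>i. complex_of_real (x i)) = mat_diag n (\<lambda>i. complex_of_real (y i))"
      by (intro eq_matI) (auto simp: mat_diag_def)
    then show "\<Phi> x = \<Phi> y" by (simp add: \<Phi>_def)
  qed
  then have "\<Phi> x \<le> \<Phi> y" by (rule gauge_dominance) (fact x y sums)+
  then show ?thesis using N_spec U V by simp
qed

section \<open>Weak majorization and norm inequality\<close>

theorem theorem4p3:
  fixes n :: nat and A B :: "complex mat" and a b :: real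
  assumes "A \<in> posdef_mats n" and "B \<in> posdef_mats n"
    and "a \<ge> 0" and "b \<ge> 0"
  shows "eigvals_decreasing
           (complex_of_real (a\<^sup>2) \<cdot>\<^sub>m A + complex_of_real (b\<^sup>2) \<cdot>\<^sub>m B
              + complex_of_real (2 * a * b) \<cdot>\<^sub>m (A \<sharp> B))
         \<prec>\<^sub>w eigvals_decreasing (W_mat a b A B)
       \<and> (\<forall>N. unitarily_invariant_norm n N \<longrightarrow>
            N (complex_of_real (a\<^sup>2) \<cdot>\<^sub>m A + complex_of_real (b\<^sup>2) \<cdot>\<^sub>m B
                 + complex_of_real (2 * a * b) \<cdot>\<^sub>m (A \<sharp> B))
            \<le> N (W_mat a b A B))"
proof -
  let ?M = "complex_of_real (a\<^sup>2) \<cdot>\<^sub>m A + complex_of_real (b\<^sup>2) \<cdot>\<^sub>m B + complex_of_real (2 * a * b) \<cdot>\<^sub>m (A \<sharp> B)"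
  note A = assms(1) and B = assms(2)
  note AC = posdef_matsD(1,2)[OF A] and BC = posdef_matsD(1,2)[OF B]
  obtain H where H: "H \<in> posdef_mats n" "H * A * H = B"
    "principal_sqrt (A * B) = A * H" "principal_sqrt (B * A) = H * A"
    by (rule principal_sqrt_transport[OF A B])
  note HC = posdef_matsD(1,2)[OF H(1)]
  have G: "A \<sharp> B \<in> posdef_mats n" by (rule geometric_mean_transport[OF A B])
  note GC = posdef_matsD(1,2)[OF G]
  have M: "?M = quad_comb a b A B (complex_of_real 2 \<cdot>\<^sub>m (A \<sharp> B))"
    unfolding quad_comb_def using AC(1) BC(1) GC(1) by (intro eq_matI) auto
  have W: "W_mat a b A B = quad_comb a b A B (A * H + H * A)"
    unfolding W_mat_def quad_comb_def H(3,4) ..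
  show ?thesis
  proof (cases "a = 0 \<and> b = 0")
    case True
    \<comment> \<open>Here \<open>a + b H\<close> is singular, but both matrices are zero.\<close>
    have "?M = W_mat a b A B"
      unfolding M W quad_comb_def using True AC(1) BC(1) GC(1) HC(1) by (intro eq_matI) auto
    then show ?thesis by (simp add: weakly_majorized_def)
  next
    case False
    then have ab: "a > 0 \<or> b > 0" using assms(3,4) by auto
    have MH: "?M \<in> carrier_mat n n" "mat_adjoint ?M = ?M"
      unfolding M using AC BC GC by (auto simp: quad_comb_adjoint mat_adjoint_smult)
    have WH: "W_mat a b A B \<in> posdef_mats n"
    proof -
      let ?K = "complex_of_real a \<cdot>\<^sub>m 1\<^sub>m n + complex_of_real b \<cdot>\<^sub>m H"
      have K: "?K \<in> posdef_mats n" by (rule posdef_affine[OF H(1) assms(3,4) ab])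
      note KC = posdef_matsD(1,2)[OF K]
      obtain L where L: "L \<in> posdef_mats n" "L * ?K = 1\<^sub>m n"
        by (rule posdef_inverse_exists[OF K])
      have "?K * A * ?K \<in> posdef_mats n"
        using posdef_congruence[OF A KC(1) posdef_matsD(1)[OF L(1)] L(2)] KC(2) by simp
      then show ?thesis unfolding W affine_congruence[OF HC(1) AC(1) refl] H(2) .
    qed
    note WC = posdef_matsD(1,2)[OF WH]
    obtain V m where V: "V \<in> carrier_mat n n" "unitary_mat V" "?M = spec_mat n V m"
      and m: "\<And>i j. i \<le> j \<Longrightarrow> j < n \<Longrightarrow> m j \<le> m i"
      using hermitian_spec_mat_decreasing[OF MH] by metis
    obtain U d where U: "U \<in> carrier_mat n n" "unitary_mat U" "W_mat a b A B = spec_mat n U d"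
      and d: "\<And>i j. i \<le> j \<Longrightarrow> j < n \<Longrightarrow> d j \<le> d i"
      using hermitian_spec_mat_decreasing[OF WC] by metis
    have dpos: "d i > 0" if "i < n" for i
      using posdef_matsD(3)[OF WH, of "col U i"] qform_spec_mat_col[OF U(2,1) that, of d]
        col_unitary_nonzero[OF U(2,1) that] U that by simp
    have mpos: "m i \<ge> 0" if "i < n" for i
    proof -
      have c: "col V i \<in> carrier_vec n" using V that by simp
      have "0 \<le> qform ?M (col V i)"
        unfolding M using AC(1) BC(1) GC(1) c assms(3,4) qform_posdef_ge_0[OF A c] qform_posdef_ge_0[OF B c] qform_posdef_ge_0[OF G c]
        by (simp add: qform_quad_comb[of _ n] qform_smult[where n = n and c = 2, simplified])
      then show ?thesis using qform_spec_mat_col[OF V(2,1) that, of m] V(3) by simp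
    qed
    have sums: "(\<Sum>i<k. m i) \<le> (\<Sum>i<k. d i)" if k: "k \<le> n" for k
    proof (cases "k = 0")
      case False
      define t where "t = d (k - 1)"
      have t: "t > 0" using dpos False k by (simp add: t_def)
      obtain M' where M': "M' \<in> carrier_mat n n" "loewner_le n (spec_mat n V m) M'"
        "loewner_le n (complex_of_real t \<cdot>\<^sub>m 1\<^sub>m n) M'" "re_trace n M' \<le> (\<Sum>i<n. max (d i) t)"
        using mean_majorant[OF A B H(1,2) assms(3,4) ab t U(1,2)] U(3) V(3) M W by metis
      show ?thesis
      proof (rule partial_sums_le[OF V(1,2) M' k])
        show "t \<le> d i" if "i < k" for i unfolding t_def using that k by (intro d) auto
        show "d i \<le> t" if "k \<le> i" "i < n" for i unfolding t_def using that by (intro d) auto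
      qed
    qed simp
    have "eigvals_decreasing ?M \<prec>\<^sub>w eigvals_decreasing (W_mat a b A B)"
    proof -
      have "eigvals_decreasing ?M = map m [0..<n]"
        unfolding V(3) by (rule eigvals_decreasing_spec_mat[OF V(1,2)]) (rule m)
      moreover have "eigvals_decreasing (W_mat a b A B) = map d [0..<n]"
        unfolding U(3) by (rule eigvals_decreasing_spec_mat[OF U(1,2)]) (rule d)
      moreover have "map m [0..<n] \<prec>\<^sub>w map d [0..<n]"
        using sums by (subst weakly_majorized_map) (auto intro: m d)
      ultimately show ?thesis by simp
    qed
    moreover have "N ?M \<le> N (W_mat a b A B)" if "unitarily_invariant_norm n N" for N
      unfolding V(3) U(3)
      by (rule fan_dominance_psd[OF that V(1,2) U(1,2)]) (use mpos m dpos sums in \<open>auto simp: less_imp_le\<close>)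
    ultimately show ?thesis by blast
  qed
qed

end
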